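(* Let $d,m\ge 1$ be fixed integers and let $\phi:\mathbb{R}^d\to\mathbb{R}^m$ be a fixed feature map. There is an algorithm which, for every $n\ge 2$, given row vectors $x_1,\dots,x_n\in\mathbb{R}^d$, matrices $W^Q,W^K,W^V\in\mathbb{R}^{d\times d}$ and real numbers $b_{-(n-1)},\dots,b_{n-1}$ such that all denominators below are nonzero, computes all the outputs of kernelized attention with relative positional encoding, $$z_i=\frac{\phi(x_iW^{Q})\sum_{j=1}^n e^{b_{j-i}}\phi(x_jW^{K})^{\top}(x_jW^{V})}{\phi(x_iW^{Q})\sum_{j=1}^n e^{b_{j-i}}\phi(x_jW^{K})^{\top}},\qquad i=1,\dots,n,$$ in time $\mathcal{O}(n\log n)$, where the implied constant depends only on $d$, $m$ and $\phi$.
   Context: Vectors are row vectors, so $\phi(x_jW^K)^{\top}(x_jW^V)$ is an $m\times d$ matrix, $\phi(x_iW^Q)$ is a $1\times m$ row vector, the denominator is a scalar, and $z_i\in\mathbb{R}^d$. Time is the number of elementary operations in exact arithmetic: additions, subtractions, multiplications and divisions of complex numbers, evaluations of the exponential function (including access to complex roots of unity), and evaluations of $\phi$, each counted as one unit (so costs depend on $n$ only through the number of operations). *)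

theory Defs
  imports "HOL-Analysis.Analysis"
begin

section \<open>The machine model\<close>

text \<open>
  An algorithm is one finite program that serves every input length. Data are complex numbers kept
  in named arrays. Control and addressing use separate registers holding natural numbers, and no
  information flows from the data back into the control. Exactly the elementary operations on data
  are counted (each costs one unit); index arithmetic, tests and jumps cost nothing.
\<close>

type_synonym name = string
type_synonym registers = "name \<Rightarrow> nat"
type_synonym arrays = "name \<Rightarrow> nat \<Rightarrow> complex"
type_synonym state = "registers \<times> arrays"

datatype iexp =
    Num nat | Reg name
  | IAdd iexp iexp | ISub iexp iexp | IMul iexp iexp | IDiv iexp iexp | IMod iexp iexp

fun ival :: "iexp \<Rightarrow> registers \<Rightarrow> nat" where
  "ival (Num k) r = k"
| "ival (Reg v) r = r v"
| "ival (IAdd e f) r = ival e r + ival f r"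
| "ival (ISub e f) r = ival e r - ival f r"
| "ival (IMul e f) r = ival e r * ival f r"
| "ival (IDiv e f) r = ival e r div ival f r"
| "ival (IMod e f) r = ival e r mod ival f r"

datatype test = Less iexp iexp | Neg test | Conj test test

fun tval :: "test \<Rightarrow> registers \<Rightarrow> bool" where
  "tval (Less e f) r \<longleftrightarrow> ival e r < ival f r"
| "tval (Neg t) r \<longleftrightarrow> \<not> tval t r"
| "tval (Conj t u) r \<longleftrightarrow> tval t r \<and> tval u r"

datatype cell = Cell name iexp

fun get :: "cell \<Rightarrow> state \<Rightarrow> complex" where
  "get (Cell a e) (r, M) = M a (ival e r)"

fun put :: "cell \<Rightarrow> complex \<Rightarrow> state \<Rightarrow> state" where
  "put (Cell a e) z (r, M) = (r, M(a := (M a)(ival e r := z)))"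

text \<open>
  A vector occupies consecutive cells, its coordinates being listed in the fixed enumeration
  \<open>coord\<close> of the finite index type.
\<close>

definition coord :: "nat \<Rightarrow> 'k::finite" where
  "coord k = from_nat_into UNIV k"

fun holds_vec :: "cell \<Rightarrow> real ^ 'k \<Rightarrow> state \<Rightarrow> bool" where
  "holds_vec (Cell a e) v (r, M) \<longleftrightarrow>
     (\<forall>k < CARD('k). M a (ival e r + k) = complex_of_real (v $ coord k))"

fun put_vec :: "cell \<Rightarrow> real ^ 'k \<Rightarrow> state \<Rightarrow> state" where
  "put_vec (Cell a e) v (r, M) =
     (r, M(a := (\<lambda>p. if ival e r \<le> p \<and> p < ival e r + CARD('k)
                     then complex_of_real (v $ coord (p - ival e r)) else M a p)))"

datatype com =
    Skip
  | Set name iexp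
  | Add cell cell cell
  | Sub cell cell cell
  | Mul cell cell cell
  | Div cell cell cell
  | Exp cell cell
  | Root cell iexp iexp
  | Feat cell cell
  | Seq com com
  | Cond test com com
  | While test com

text \<open>
  \<open>exec \<phi> c s t s'\<close>: started in \<open>s\<close>, the program \<open>c\<close> halts in \<open>s'\<close> after \<open>t\<close> elementary
  operations. The first argument of an operation is its destination. There is no rule for dividing
  by \<open>0\<close>, for a root of unity of order \<open>0\<close>, or for applying \<open>\<phi>\<close> to cells that are not real: a program
  attempting this gets stuck. In particular neither the convention \<open>z / 0 = 0\<close> nor the projection
  to the real part is available to programs.
\<close>

inductive exec :: "(real ^ 'd \<Rightarrow> real ^ 'm) \<Rightarrow> com \<Rightarrow> state \<Rightarrow> nat \<Rightarrow> state \<Rightarrow> bool"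
  for \<phi> :: "real ^ 'd \<Rightarrow> real ^ 'm" where
  Skip: "exec \<phi> Skip s 0 s"
| Set: "exec \<phi> (Set v e) (r, M) 0 (r(v := ival e r), M)"
| Add: "exec \<phi> (Add c a b) s 1 (put c (get a s + get b s) s)"
| Sub: "exec \<phi> (Sub c a b) s 1 (put c (get a s - get b s) s)"
| Mul: "exec \<phi> (Mul c a b) s 1 (put c (get a s * get b s) s)"
| Div: "get b s \<noteq> 0 \<Longrightarrow> exec \<phi> (Div c a b) s 1 (put c (get a s / get b s) s)"
| Exp: "exec \<phi> (Exp c a) s 1 (put c (exp (get a s)) s)"
| Root: "ival e (fst s) > 0 \<Longrightarrow>
    exec \<phi> (Root c e f) s 1
      (put c (exp (2 * of_real pi * \<i> * of_nat (ival f (fst s)) / of_nat (ival e (fst s)))) s)"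
| Feat: "holds_vec a v s \<Longrightarrow> exec \<phi> (Feat c a) s 1 (put_vec c (\<phi> v) s)"
| Seq: "exec \<phi> p s t s' \<Longrightarrow> exec \<phi> q s' u s'' \<Longrightarrow> exec \<phi> (Seq p q) s (t + u) s''"
| CondTrue: "tval g (fst s) \<Longrightarrow> exec \<phi> p s t s' \<Longrightarrow> exec \<phi> (Cond g p q) s t s'"
| CondFalse: "\<not> tval g (fst s) \<Longrightarrow> exec \<phi> q s t s' \<Longrightarrow> exec \<phi> (Cond g p q) s t s'"
| WhileFalse: "\<not> tval g (fst s) \<Longrightarrow> exec \<phi> (While g p) s 0 s"
| WhileTrue: "tval g (fst s) \<Longrightarrow> exec \<phi> p s t s' \<Longrightarrow> exec \<phi> (While g p) s' u s'' \<Longrightarrow>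
    exec \<phi> (While g p) s (t + u) s''"

lemma coord_surj: "\<exists>k < CARD('k). coord k = (i :: 'k::finite)"
proof -
  have "bij_betw (coord :: nat \<Rightarrow> 'k) {..<CARD('k)} UNIV"
    using bij_betw_from_nat_into_finite[of "UNIV :: 'k set"]
    by (simp add: coord_def[abs_def])
  then show ?thesis
    by (metis UNIV_I bij_betw_iff_bijections lessThan_iff)
qed

lemma holds_vec_unique:
  assumes "holds_vec a (v :: real ^ 'k) s" "holds_vec a w s"
  shows "v = w"
proof -
  obtain n e where a: "a = Cell n e" by (cases a)
  obtain r M where s: "s = (r, M)" by (cases s)
  have eq: "v $ coord k = w $ coord k" if "k < CARD('k)" for k
  proof -
    have "M n (ival e r + k) = complex_of_real (v $ coord k)"
         "M n (ival e r + k) = complex_of_real (w $ coord k)"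
      using assms that unfolding a s by simp_all
    then show ?thesis
      by simp
  qed
  have "v $ i = w $ i" for i
    using coord_surj[of i] eq by metis
  then show ?thesis by (simp add: vec_eq_iff)
qed

text \<open>Result and cost of a halting program are determined by its initial state.\<close>

lemma exec_determ:
  assumes "exec \<phi> c s t s'" "exec \<phi> c s u s''"
  shows "u = t \<and> s'' = s'"
  using assms
proof (induction arbitrary: u s'' rule: exec.induct)
  case (Feat a v s c)
  from Feat(2) show ?case
    by (cases rule: exec.cases) (use Feat(1) holds_vec_unique in blast)+
next
  case (Seq p s t s' q u' s''')
  from Seq(5) show ?case
    by (cases rule: exec.cases) (use Seq.IH in blast)+
next
  case (CondTrue g s p t s' q)
  from CondTrue(4) show ?case
    by (cases rule: exec.cases) (use CondTrue in blast)+
next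
  case (CondFalse g s q t s' p)
  from CondFalse(4) show ?case
    by (cases rule: exec.cases) (use CondFalse in blast)+
next
  case (WhileTrue g s p t s' u' s''')
  from WhileTrue(6) show ?case
    by (cases rule: exec.cases) (use WhileTrue in blast)+
qed (erule exec.cases; simp)+

section \<open>Kernelized attention with relative positional encoding\<close>

text \<open>Vectors are row vectors: \<open>x v* W\<close> is the product \<open>x W\<close>.\<close>

definition attention_num ::
  "(real ^ 'd \<Rightarrow> real ^ 'm) \<Rightarrow> nat \<Rightarrow> (nat \<Rightarrow> real ^ 'd) \<Rightarrow>
   real ^ 'd ^ 'd \<Rightarrow> real ^ 'd ^ 'd \<Rightarrow> real ^ 'd ^ 'd \<Rightarrow> (int \<Rightarrow> real) \<Rightarrow> nat \<Rightarrow> real ^ 'd" where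
  "attention_num \<phi> n x WQ WK WV b i =
     \<phi> (x i v* WQ) v*
       (\<Sum>j = 1..n. exp (b (int j - int i)) *\<^sub>R
          ((columnvector (\<phi> (x j v* WK)) :: real ^ 1 ^ 'm) **
           (rowvector (x j v* WV) :: real ^ 'd ^ 1)))"

definition attention_den ::
  "(real ^ 'd \<Rightarrow> real ^ 'm) \<Rightarrow> nat \<Rightarrow> (nat \<Rightarrow> real ^ 'd) \<Rightarrow>
   real ^ 'd ^ 'd \<Rightarrow> real ^ 'd ^ 'd \<Rightarrow> (int \<Rightarrow> real) \<Rightarrow> nat \<Rightarrow> real" where
  "attention_den \<phi> n x WQ WK b i =
     \<phi> (x i v* WQ) \<bullet> (\<Sum>j = 1..n. exp (b (int j - int i)) *\<^sub>R \<phi> (x j v* WK))"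

definition attention ::
  "(real ^ 'd \<Rightarrow> real ^ 'm) \<Rightarrow> nat \<Rightarrow> (nat \<Rightarrow> real ^ 'd) \<Rightarrow>
   real ^ 'd ^ 'd \<Rightarrow> real ^ 'd ^ 'd \<Rightarrow> real ^ 'd ^ 'd \<Rightarrow> (int \<Rightarrow> real) \<Rightarrow> nat \<Rightarrow> real ^ 'd" where
  "attention \<phi> n x WQ WK WV b i =
     attention_num \<phi> n x WQ WK WV b i /\<^sub>R attention_den \<phi> n x WQ WK b i"

section \<open>Input and output conventions\<close>

text \<open>
  Matrices and the sequence \<open>x\<^sub>1, \<dots>, x\<^sub>n\<close> are stored row by row, and \<open>b\<^sub>l\<close> is stored at position
  \<open>l + (n - 1)\<close>. All remaining cells and registers are zero, so that a program sees
  nothing but the data of the problem.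
\<close>

definition mat_entries :: "real ^ 'd ^ 'd \<Rightarrow> nat \<Rightarrow> complex" where
  "mat_entries W p =
     (if p < CARD('d) * CARD('d)
      then complex_of_real (W $ coord (p div CARD('d)) $ coord (p mod CARD('d))) else 0)"

definition input_state ::
  "nat \<Rightarrow> (nat \<Rightarrow> real ^ 'd) \<Rightarrow>
   real ^ 'd ^ 'd \<Rightarrow> real ^ 'd ^ 'd \<Rightarrow> real ^ 'd ^ 'd \<Rightarrow> (int \<Rightarrow> real) \<Rightarrow> state" where
  "input_state n x WQ WK WV b =
     ((\<lambda>_. 0)(''n'' := n),
      (\<lambda>_ _. 0)
        (''x'' := (\<lambda>p. if p < n * CARD('d)
            then complex_of_real (x (p div CARD('d) + 1) $ coord (p mod CARD('d))) else 0),
         ''WQ'' := mat_entries WQ,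
         ''WK'' := mat_entries WK,
         ''WV'' := mat_entries WV,
         ''b'' := (\<lambda>p. if p < 2 * n - 1
            then complex_of_real (b (int p - (int n - 1))) else 0)))"

definition outputs :: "state \<Rightarrow> nat \<Rightarrow> (nat \<Rightarrow> real ^ 'd) \<Rightarrow> bool" where
  "outputs s n z \<longleftrightarrow>
     (\<forall>i \<in> {1..n}. \<forall>k < CARD('d).
        snd s ''z'' ((i - 1) * CARD('d) + k) = complex_of_real (z i $ coord k))"

end

theory Submission
  imports Defs
begin

text \<open>
  Numerators and denominators are linear combinations, with coefficients from \<open>\<phi> (x\<^sub>i W\<^sup>Q)\<close>, of
  \<open>m (d + 1)\<close> products of the Toeplitz matrix with entries \<open>exp (b\<^sub>j\<^sub>-\<^sub>i)\<close> with vectors of length \<open>n\<close>.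
  Each such product is read off a cyclic convolution whose length is a power of two of order \<open>n\<close>,
  and the convolutions are computed by fast Fourier transforms. A second forward transform
  replaces the inverse transform: it only reverses the order and multiplies everything by the
  length, and this factor cancels in the quotient.
\<close>

section \<open>Total correctness with costs\<close>

text \<open>Two features of the machine shape the proof. Programs can neither recurse nor test data,
  so the transform has to be iterative, with every address given by a closed formula in loop
  counters; in return, all numbers of iterations are known beforehand. And because no cell is
  overwritten, one table of final contents specifies every piece of the program: an invariant only
  records how far each array has been filled, and no piece has to be shown to preserve the results
  of another. All \<open>m * (d + 1)\<close> sequences and the kernel are interleaved with stride
  \<open>Q = m * (d + 1) + 1\<close> in one array of length \<open>Q * 2 ^ L\<close>. A radix-two
  transform of this array that is stopped after \<open>L\<close> rounds consists of \<open>Q\<close>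
  independent transforms of length \<open>2 ^ L\<close>, so a single loop treats the whole batch
  although \<open>Q\<close> need not be a power of two. Complex arithmetic does not interfere with
  the feature map: it is applied before any transform, to cells that hold exact real
  numbers.\<close>

definition achieves ::
  "(real ^ 'd \<Rightarrow> real ^ 'm) \<Rightarrow> (state \<Rightarrow> bool) \<Rightarrow> com \<Rightarrow> nat \<Rightarrow> (state \<Rightarrow> bool) \<Rightarrow> bool" where
  "achieves \<phi> A c t B \<longleftrightarrow> (\<forall>s. A s \<longrightarrow> (\<exists>t' s'. exec \<phi> c s t' s' \<and> t' \<le> t \<and> B s'))"

lemma achieves_conseq:
  assumes "achieves \<phi> A c t B" "\<And>s. A' s \<Longrightarrow> A s" "\<And>s. B s \<Longrightarrow> B' s" "t \<le> t'"
  shows "achieves \<phi> A' c t' B'"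
  using assms unfolding achieves_def by (meson order_trans)

lemma achieves_Seq:
  assumes "achieves \<phi> A p t B" "achieves \<phi> B q u C"
  shows "achieves \<phi> A (Seq p q) (t + u) C"
  unfolding achieves_def
proof (intro allI impI)
  fix s assume "A s"
  then obtain t' s' where 1: "exec \<phi> p s t' s'" "t' \<le> t" "B s'"
    using assms(1) unfolding achieves_def by blast
  then obtain u' s'' where 2: "exec \<phi> q s' u' s''" "u' \<le> u" "C s''"
    using assms(2) unfolding achieves_def by blast
  show "\<exists>t' s'. exec \<phi> (Seq p q) s t' s' \<and> t' \<le> t + u \<and> C s'"
    using exec.Seq[OF 1(1) 2(1)] 1 2 by (meson add_mono)
qed

text \<open>The number \<open>N\<close> of rounds can be fixed in advance because tests read
  registers only; the indexed family \<open>A\<close> is invariant and progress measure at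
  once.\<close>

lemma achieves_While:
  assumes step: "\<And>k. k < N \<Longrightarrow> achieves \<phi> (A k) p t (A (Suc k))"
    and go: "\<And>k s. k < N \<Longrightarrow> A k s \<Longrightarrow> tval g (fst s)"
    and stop: "\<And>s. A N s \<Longrightarrow> \<not> tval g (fst s)"
  shows "achieves \<phi> (A 0) (While g p) (N * t) (A N)"
proof -
  \<comment> \<open>Induction on the number of rounds still to run, since
    \<open>exec.WhileTrue\<close> peels off the first round.\<close>
  have "achieves \<phi> (A (N - j)) (While g p) (j * t) (A N)" if "j \<le> N" for j
    using that
  proof (induction j)
    case 0
    then show ?case
      unfolding achieves_def using stop exec.WhileFalse by fastforce
  next
    case (Suc j)
    define k where "k = N - Suc j"
    have k: "k < N" "N - j = Suc k" "N - Suc j = k"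
      using Suc.prems by (auto simp: k_def)
    have IH: "achieves \<phi> (A (Suc k)) (While g p) (j * t) (A N)"
      using Suc k by simp
    show ?case
      unfolding achieves_def k(3)
    proof (intro allI impI)
      fix s assume s: "A k s"
      obtain t1 s1 where 1: "exec \<phi> p s t1 s1" "t1 \<le> t" "A (Suc k) s1"
        using step[OF k(1)] s unfolding achieves_def by blast
      obtain t2 s2 where 2: "exec \<phi> (While g p) s1 t2 s2" "t2 \<le> j * t" "A N s2"
        using IH 1(3) unfolding achieves_def by blast
      have "exec \<phi> (While g p) s (t1 + t2) s2"
        by (rule exec.WhileTrue[OF go[OF k(1) s] 1(1) 2(1)])
      then show "\<exists>t' s'. exec \<phi> (While g p) s t' s' \<and> t' \<le> Suc j * t \<and> A N s'"
        using 1(2) 2(2,3) by (metis add_mono mult_Suc)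
    qed
  qed
  from this[of N] show ?thesis by simp
qed

section \<open>Arrays that are filled from left to right\<close>

text \<open>
  The programs below never overwrite a cell: \<open>F\<close> prescribes the final contents of all arrays, and
  \<open>S a\<close> is the length of the part of \<open>a\<close> that has already been computed.
\<close>

definition good :: "arrays \<Rightarrow> (name \<Rightarrow> nat) \<Rightarrow> (registers \<Rightarrow> bool) \<Rightarrow> state \<Rightarrow> bool" where
  "good F S R s \<longleftrightarrow> R (fst s) \<and> (\<forall>a p. p < S a \<longrightarrow> snd s a p = F a p)"

text \<open>Once a single register valuation is fixed, addresses are concrete numbers, and the rules
  for operations can state their side conditions outside the assertions about states.\<close>

lemma achieves_good_regs:
  assumes "\<And>r. R r \<Longrightarrow> achieves \<phi> (good F S ((=) r)) c t B"
  shows "achieves \<phi> (good F S R) c t B"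
  using assms unfolding achieves_def good_def by blast

lemma achieves_Cond:
  assumes "tval g r \<Longrightarrow> achieves \<phi> (good F S ((=) r)) p t B"
    and "\<not> tval g r \<Longrightarrow> achieves \<phi> (good F S ((=) r)) q t B"
  shows "achieves \<phi> (good F S ((=) r)) (Cond g p q) t B"
  using assms unfolding achieves_def good_def
  by (metis exec.CondTrue exec.CondFalse)

lemma achieves_Set:
  "achieves \<phi> (good F S ((=) r)) (Set v e) 0 (good F S ((=) (r(v := ival e r))))"
proof -
  have "\<exists>t' s'. exec \<phi> (Set v e) s t' s' \<and> t' \<le> 0 \<and> good F S ((=) (r(v := ival e r))) s'"
    if s: "good F S ((=) r) s" for s
  proof -
    obtain M where "s = (r, M)"
      using s by (cases s) (auto simp: good_def)
    then show ?thesis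
      using exec.Set[of \<phi> v e r M] s by (auto simp: good_def)
  qed
  then show ?thesis
    unfolding achieves_def by blast
qed

lemma good_put:
  assumes "good F S R s" "ival e (fst s) = S a" "z = F a (S a)"
  shows "good F (S(a := Suc (S a))) R (put (Cell a e) z s)"
  using assms by (cases s) (auto simp: good_def less_Suc_eq)

lemma good_get:
  assumes "good F S ((=) r) s" "ival e r < S a"
  shows "get (Cell a e) s = F a (ival e r)"
  using assms by (cases s) (auto simp: good_def)

text \<open>Writing at position \<open>S a\<close> leaves all known prefixes intact and lengthens
  one of them. The new lengths enter through a separate equation so that they may be presented with
  any arrangement of updates.\<close>

lemma achieves_put:
  assumes "\<And>s. good F S ((=) r) s \<Longrightarrow> exec \<phi> c s 1 (put (Cell a e) (F a (S a)) s)"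
    and "ival e r = S a" and S': "S' = S(a := Suc (S a))"
  shows "achieves \<phi> (good F S ((=) r)) c 1 (good F S' ((=) r))"
  unfolding achieves_def S'
proof (intro allI impI)
  fix s assume s: "good F S ((=) r) s"
  then have "ival e (fst s) = S a"
    using assms(2) by (simp add: good_def)
  then show "\<exists>t' s'. exec \<phi> c s t' s' \<and> t' \<le> 1 \<and> good F (S(a := Suc (S a))) ((=) r) s'"
    using assms(1)[OF s] good_put[OF s _ refl] by blast
qed

lemma good_regsD: "good F S ((=) r) s \<Longrightarrow> fst s = r"
  by (simp add: good_def)

lemma achieves_Add:
  assumes "ival e r = S a" "ival f r < S b" "ival g r < S c"
    and "F a (S a) = F b (ival f r) + F c (ival g r)" and S': "S' = S(a := Suc (S a))"
  shows "achieves \<phi> (good F S ((=) r)) (Add (Cell a e) (Cell b f) (Cell c g)) 1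
    (good F S' ((=) r))"
proof (rule achieves_put)
  fix s assume s: "good F S ((=) r) s"
  show "exec \<phi> (Add (Cell a e) (Cell b f) (Cell c g)) s 1 (put (Cell a e) (F a (S a)) s)"
    using exec.Add[of \<phi> "Cell a e" "Cell b f" "Cell c g" s] good_get[OF s assms(2)] good_get[OF s assms(3)] assms(4)
    by (simp del: get.simps put.simps)
qed (fact assms(1), fact S')

lemma achieves_Mul:
  assumes "ival e r = S a" "ival f r < S b" "ival g r < S c"
    and "F a (S a) = F b (ival f r) * F c (ival g r)" and S': "S' = S(a := Suc (S a))"
  shows "achieves \<phi> (good F S ((=) r)) (Mul (Cell a e) (Cell b f) (Cell c g)) 1
    (good F S' ((=) r))"
proof (rule achieves_put)
  fix s assume s: "good F S ((=) r) s"
  show "exec \<phi> (Mul (Cell a e) (Cell b f) (Cell c g)) s 1 (put (Cell a e) (F a (S a)) s)"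
    using exec.Mul[of \<phi> "Cell a e" "Cell b f" "Cell c g" s] good_get[OF s assms(2)] good_get[OF s assms(3)] assms(4)
    by (simp del: get.simps put.simps)
qed (fact assms(1), fact S')

lemma achieves_Div:
  assumes "ival e r = S a" "ival f r < S b" "ival g r < S c"
    and "F a (S a) = F b (ival f r) / F c (ival g r)" "F c (ival g r) \<noteq> 0" and S': "S' = S(a := Suc (S a))"
  shows "achieves \<phi> (good F S ((=) r)) (Div (Cell a e) (Cell b f) (Cell c g)) 1
    (good F S' ((=) r))"
proof (rule achieves_put)
  fix s assume s: "good F S ((=) r) s"
  show "exec \<phi> (Div (Cell a e) (Cell b f) (Cell c g)) s 1 (put (Cell a e) (F a (S a)) s)"
    using exec.Div[of "Cell c g" s \<phi> "Cell a e" "Cell b f"] good_get[OF s assms(2)] good_get[OF s assms(3)] assms(4,5)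
    by (simp del: get.simps put.simps)
qed (fact assms(1), fact S')

lemma achieves_Exp:
  assumes "ival e r = S a" "ival f r < S b" "F a (S a) = exp (F b (ival f r))" and S': "S' = S(a := Suc (S a))"
  shows "achieves \<phi> (good F S ((=) r)) (Exp (Cell a e) (Cell b f)) 1
    (good F S' ((=) r))"
proof (rule achieves_put)
  fix s assume s: "good F S ((=) r) s"
  show "exec \<phi> (Exp (Cell a e) (Cell b f)) s 1 (put (Cell a e) (F a (S a)) s)"
    using exec.Exp[of \<phi> "Cell a e" "Cell b f" s] good_get[OF s assms(2)] assms(3)
    by (simp del: get.simps put.simps)
qed (fact assms(1), fact S')

definition unity_root :: "nat \<Rightarrow> nat \<Rightarrow> complex" where
  "unity_root N k = exp (2 * of_real pi * \<i> * of_nat k / of_nat N)"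

lemma achieves_Root:
  assumes "ival e r = S a" "ival f r > 0" "F a (S a) = unity_root (ival f r) (ival g r)" and S': "S' = S(a := Suc (S a))"
  shows "achieves \<phi> (good F S ((=) r)) (Root (Cell a e) f g) 1
    (good F S' ((=) r))"
proof (rule achieves_put)
  fix s assume s: "good F S ((=) r) s"
  show "exec \<phi> (Root (Cell a e) f g) s 1 (put (Cell a e) (F a (S a)) s)"
    using exec.Root[of f s \<phi> "Cell a e" g] assms good_regsD[OF s]
    by (simp add: unity_root_def del: put.simps)
qed (fact assms(1), fact S')

text \<open>The vector \<open>v\<close> certifies that the cells read are real, without which
  \<open>exec.Feat\<close> does not apply. One operation fills \<open>CARD('m)\<close>
  cells.\<close>

lemma achieves_Feat:
  fixes \<phi> :: "real ^ 'd \<Rightarrow> real ^ 'm"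
  assumes "ival e r = S a" "ival f r + CARD('d) \<le> S b"
    and "\<And>k. k < CARD('d) \<Longrightarrow> F b (ival f r + k) = complex_of_real (v $ coord k)"
    and "\<And>k. k < CARD('m) \<Longrightarrow> F a (S a + k) = complex_of_real (\<phi> v $ coord k)"
  shows "achieves \<phi> (good F S ((=) r)) (Feat (Cell a e) (Cell b f)) 1
    (good F (S(a := S a + CARD('m))) ((=) r))"
  unfolding achieves_def
proof (intro allI impI)
  fix s assume s: "good F S ((=) r) s"
  obtain M where sM: "s = (r, M)"
    using s by (cases s) (auto simp: good_def)
  have M: "M a p = F a p" if "p < S a" for a p
    using s that by (simp add: good_def sM)
  have "holds_vec (Cell b f) v s"
    using assms(2,3) M by (simp add: sM)
  moreover have "F a p = complex_of_real (\<phi> v $ coord (p - S a))"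
    if "S a \<le> p" "p < S a + CARD('m)" for p
    using assms(4)[of "p - S a"] that by auto
  then have "good F (S(a := S a + CARD('m))) ((=) r) (put_vec (Cell a e) (\<phi> v) s)"
    using assms(1) M by (auto simp: good_def sM not_less)
  ultimately show "\<exists>t' s'. exec \<phi> (Feat (Cell a e) (Cell b f)) s t' s' \<and> t' \<le> 1 \<and>
      good F (S(a := S a + CARD('m))) ((=) r) s'"
    using exec.Feat[of "Cell b f" v s \<phi> "Cell a e"] by blast
qed

section \<open>The fast Fourier transform\<close>

lemma unity_root_add: "unity_root N (a + b) = unity_root N a * unity_root N b"
  by (simp add: unity_root_def flip: exp_add) (simp add: algebra_simps add_divide_distrib)

lemma unity_root_power: "unity_root N (k * a) = unity_root N a ^ k"
  by (simp add: unity_root_def ac_simps flip: exp_of_nat_mult)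

lemma unity_root_eq_1_iff:
  assumes "N > 0"
  shows "unity_root N a = 1 \<longleftrightarrow> N dvd a"
  using complex_root_unity_eq[of N a 0] assms
  by (simp add: unity_root_def cong_def dvd_eq_mod_eq_0)

lemma unity_root_mod: "unity_root N (k mod N) = unity_root N k"
proof (cases "N = 0")
  case False
  have "unity_root N k = unity_root N (k div N * N + k mod N)"
    by simp
  also have "\<dots> = unity_root N (k mod N)"
    using False by (subst unity_root_add) (simp add: unity_root_eq_1_iff)
  finally show ?thesis ..
qed simp

lemma unity_root_double: "unity_root (2 * N) (2 * k) = unity_root N k"
  by (simp add: unity_root_def mult_ac)

text \<open>Orthogonality: if \<open>N\<close> does not divide \<open>a\<close>, the ratio of the
  geometric sum differs from 1 while its \<open>N\<close>-th power is 1.\<close>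

lemma unity_root_sum:
  assumes "N > 0"
  shows "(\<Sum>k<N. unity_root N (k * a)) = (if N dvd a then of_nat N else 0)"
proof (cases "N dvd a")
  case True
  then have "unity_root N (k * a) = 1" for k
    using assms by (simp add: unity_root_eq_1_iff)
  then show ?thesis
    using True by simp
next
  case False
  have "unity_root N a ^ N = 1"
    using assms by (simp add: unity_root_eq_1_iff flip: unity_root_power)
  then show ?thesis
    using False assms geometric_sum[of "unity_root N a" N]
    by (simp add: unity_root_power unity_root_eq_1_iff)
qed

lemma sum_lessThan_double:
  fixes f :: "nat \<Rightarrow> 'a::comm_monoid_add"
  shows "(\<Sum>j<2 * N. f j) = (\<Sum>j<N. f (2 * j)) + (\<Sum>j<N. f (2 * j + 1))"
  by (induction N) (simp_all add: ac_simps)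

text \<open>
  The state of a batch of interleaved transforms after \<open>s\<close> rounds: writing \<open>w = q * 2 ^ s + k\<close> with
  \<open>k < 2 ^ s\<close>, entry \<open>w\<close> is coefficient \<open>k\<close> of the discrete Fourier transform of length \<open>2 ^ s\<close> of
  the subsequence of \<open>u\<close> that starts at \<open>q\<close> and has step \<open>T div 2 ^ s\<close>.
\<close>

definition fft_round :: "nat \<Rightarrow> (nat \<Rightarrow> complex) \<Rightarrow> nat \<Rightarrow> nat \<Rightarrow> complex" where
  "fft_round T u s w =
     (\<Sum>j<2 ^ s. u (w div 2 ^ s + j * (T div 2 ^ s)) * unity_root (2 ^ s) (j * (w mod 2 ^ s)))"

text \<open>The address in round \<open>s - 1\<close> read for entry \<open>w\<close> of round
  \<open>s\<close>. Splitting by parity doubles the step, the odd part starts one old step later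
  (\<open>c = 1\<close>), and the frequency is reduced modulo half the length. This is the
  self-sorting (Stockham) layout, which avoids bit reversal.\<close>

definition fft_source :: "nat \<Rightarrow> nat \<Rightarrow> nat \<Rightarrow> nat \<Rightarrow> nat" where
  "fft_source T s w c =
     (w div 2 ^ s + c * (T div 2 ^ s)) * 2 ^ (s - 1) + (w mod 2 ^ s) mod 2 ^ (s - 1)"

lemma flat_less:
  fixes q k :: nat
  assumes "q < B" "k < K"
  shows "q * K + k < B * K"
proof -
  have "q * K + k < Suc q * K"
    using assms by simp
  also have "\<dots> \<le> B * K"
    using assms by (intro mult_le_mono1) simp
  finally show ?thesis .
qed

lemma flat_div: "k < K \<Longrightarrow> (q * K + k) div K = q" for q k K :: nat
  by simp

lemma flat_mod: "k < K \<Longrightarrow> (q * K + k) mod K = k" for q k K :: nat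
  by simp

lemma fft_round_0: "fft_round T u 0 w = u w"
  by (simp add: fft_round_def unity_root_def)

lemma fft_source_less:
  assumes "2 ^ Suc s dvd T" "w < T" "c < 2"
  shows "fft_source T (Suc s) w c < T"
proof -
  obtain M where M: "T = 2 ^ Suc s * M"
    using assms(1) by (elim dvdE)
  have "w div 2 ^ Suc s < M"
    using assms(2) by (simp add: M div_less_iff_less_mult mult.commute)
  then have "w div 2 ^ Suc s + c * M < 2 * M"
    using assms(3) by (cases c) auto
  then have "(w div 2 ^ Suc s + c * M) * 2 ^ s + (w mod 2 ^ Suc s) mod 2 ^ s < 2 * M * 2 ^ s"
    by (rule flat_less) simp
  then show ?thesis
    by (simp add: fft_source_def M mult_ac)
qed

text \<open>The Cooley-Tukey split by parity of \<open>j\<close>. The upper half of the coefficients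
  needs no second formula with a minus sign: the root in front changes its sign by itself when the
  frequency grows by half the length.\<close>

lemma fft_round_Suc:
  assumes "2 ^ Suc s dvd T"
  shows "fft_round T u (Suc s) w =
    fft_round T u s (fft_source T (Suc s) w 0) +
    unity_root (2 ^ Suc s) (w mod 2 ^ Suc s) * fft_round T u s (fft_source T (Suc s) w 1)"
proof -
  define H :: nat where "H = 2 ^ s"
  define q where "q = w div (2 * H)"
  define k where "k = w mod (2 * H)"
  obtain M where M: "T = 2 * H * M"
    using assms by (auto simp: H_def elim: dvdE)
  have H: "H > 0" "2 ^ Suc s = 2 * H" "2 ^ s = H"
    by (simp_all add: H_def)
  have T: "T div H = 2 * M" "T div (2 * H) = M"
    using H(1) by (simp_all add: M)
  \<comment> \<open>Even indices involve only roots of order \<open>H\<close>, so the frequency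
    matters only modulo \<open>H\<close>.\<close>
  have root: "unity_root H (j * (k mod H)) = unity_root (2 * H) (2 * j * k)" for j
    by (metis mod_mult_right_eq mult.assoc unity_root_double unity_root_mod)
  have source: "fft_source T (Suc s) w c div H = q + c * M"
      "fft_source T (Suc s) w c mod H = k mod H" for c
    using H(1) by (simp_all add: fft_source_def H(3) q_def k_def T H(2) flip: power_Suc)
  have "fft_round T u (Suc s) w = (\<Sum>j<2 * H. u (q + j * M) * unity_root (2 * H) (j * k))"
    by (simp add: fft_round_def H q_def k_def T flip: power_Suc)
  also have "\<dots> = (\<Sum>j<H. u (q + 2 * j * M) * unity_root (2 * H) (2 * j * k)) +
      (\<Sum>j<H. u (q + (2 * j + 1) * M) * unity_root (2 * H) ((2 * j + 1) * k))"
    by (rule sum_lessThan_double)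
  also have "(\<Sum>j<H. u (q + 2 * j * M) * unity_root (2 * H) (2 * j * k)) =
      fft_round T u s (fft_source T (Suc s) w 0)"
    unfolding fft_round_def H source T root by (simp add: mult_ac)
  also have "(\<Sum>j<H. u (q + (2 * j + 1) * M) * unity_root (2 * H) ((2 * j + 1) * k)) =
      unity_root (2 * H) k * fft_round T u s (fft_source T (Suc s) w 1)"
    unfolding fft_round_def H source T root sum_distrib_left
    by (intro sum.cong) (simp_all add: algebra_simps unity_root_add)
  finally show ?thesis
    by (simp only: H k_def)
qed

text \<open>After \<open>L\<close> rounds the step has become \<open>Q\<close>, so interleaved
  inputs yield contiguous spectra, one block of length \<open>2 ^ L\<close> for each starting point
  \<open>c\<close>.\<close>

lemma fft_round_last:
  assumes "k < 2 ^ L"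
  shows "fft_round (Q * 2 ^ L) u L (c * 2 ^ L + k) =
    (\<Sum>j<2 ^ L. u (j * Q + c) * unity_root (2 ^ L) (j * k))"
  using assms by (simp add: fft_round_def add_ac)

section \<open>Cyclic convolution and Toeplitz products\<close>

text \<open>Transforming twice reverses the order, hence the sum \<open>j + l + i\<close> instead of a difference.\<close>

lemma fourier_convolution:
  fixes a h :: "nat \<Rightarrow> complex"
  assumes "N > 0"
  shows "(\<Sum>k<N. (\<Sum>j<N. a j * unity_root N (j * k)) * (\<Sum>l<N. h l * unity_root N (l * k)) *
      unity_root N (k * i)) =
    of_nat N * (\<Sum>j<N. a j * (\<Sum>l<N. if N dvd j + l + i then h l else 0))"
proof -
  have "(\<Sum>k<N. (\<Sum>j<N. a j * unity_root N (j * k)) * (\<Sum>l<N. h l * unity_root N (l * k)) *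
      unity_root N (k * i)) =
    (\<Sum>k<N. \<Sum>j<N. \<Sum>l<N. a j * h l * unity_root N (k * (j + l + i)))"
    unfolding sum_product sum_distrib_right distrib_left unity_root_add
    by (intro sum.cong refl) (simp add: sum_distrib_left mult_ac)
  also have "\<dots> = (\<Sum>j<N. \<Sum>k<N. \<Sum>l<N. a j * h l * unity_root N (k * (j + l + i)))"
    by (rule sum.swap)
  also have "\<dots> = (\<Sum>j<N. \<Sum>l<N. \<Sum>k<N. a j * h l * unity_root N (k * (j + l + i)))"
    by (rule sum.cong[OF refl], rule sum.swap)
  also have "\<dots> = (\<Sum>j<N. \<Sum>l<N. a j * h l * (if N dvd j + l + i then of_nat N else 0))"
    by (simp add: unity_root_sum[OF assms] flip: sum_distrib_left)
  also have "\<dots> = of_nat N * (\<Sum>j<N. a j * (\<Sum>l<N. if N dvd j + l + i then h l else 0))"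
    unfolding sum_distrib_left by (intro sum.cong refl) auto
  finally show ?thesis .
qed

text \<open>No wrap-around occurs because \<open>N \<ge> 2 * n - 1\<close>.\<close>

lemma toeplitz_via_fourier:
  fixes a h :: "nat \<Rightarrow> complex"
  assumes N: "2 * n - 1 \<le> N" and i: "i < n" and n: "n \<ge> 2"
    and a: "\<And>j. j \<ge> n \<Longrightarrow> a j = 0"
  shows "(\<Sum>k<N. (\<Sum>j<N. a j * unity_root N (j * k)) * (\<Sum>l<N. h l * unity_root N (l * k)) *
      unity_root N (k * (N - (i + n - 1)))) =
    of_nat N * (\<Sum>j<n. a j * h (i + n - 1 - j))"
proof -
  have N0: "N > 0"
    using N n by simp
  have inner: "(\<Sum>l<N. if N dvd j + l + (N - (i + n - 1)) then h l else 0) = h (i + n - 1 - j)"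
    if j: "j < n" for j
  proof -
    \<comment> \<open>The bounds on \<open>i\<close>, \<open>j\<close>, \<open>l\<close> and
      \<open>N\<close> place the sum strictly between 0 and \<open>2 * N\<close>, so the only
      possible multiple is \<open>N\<close> itself.\<close>
    have "N dvd j + l + (N - (i + n - 1)) \<longleftrightarrow> l = i + n - 1 - j" if l: "l < N" for l
    proof
      assume "N dvd j + l + (N - (i + n - 1))"
      then obtain c where c: "j + l + (N - (i + n - 1)) = N * c" ..
      have "0 < N * c" "N * c < N * 2"
        using c[symmetric] l j i N n by linarith+
      then have "c = 1"
        by (cases c) auto
      then show "l = i + n - 1 - j"
        using c i j l N n by simp
    next
      assume "l = i + n - 1 - j"
      then have "j + l + (N - (i + n - 1)) = N"
        using i j N n by linarith
      then show "N dvd j + l + (N - (i + n - 1))"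
        by simp
    qed
    then have "(\<Sum>l<N. if N dvd j + l + (N - (i + n - 1)) then h l else 0) =
        (\<Sum>l<N. if l = i + n - 1 - j then h l else 0)"
      by (intro sum.cong) auto
    also have "\<dots> = h (i + n - 1 - j)"
      using i j N n by simp
    finally show ?thesis .
  qed
  have "(\<Sum>j<N. a j * (\<Sum>l<N. if N dvd j + l + (N - (i + n - 1)) then h l else 0)) =
      (\<Sum>j<n. a j * (\<Sum>l<N. if N dvd j + l + (N - (i + n - 1)) then h l else 0))"
    using N n a by (intro sum.mono_neutral_right) auto
  also have "\<dots> = (\<Sum>j<n. a j * h (i + n - 1 - j))"
    using inner by (intro sum.cong) auto
  finally show ?thesis
    using fourier_convolution[OF N0, of a h "N - (i + n - 1)"] by simp
qed

section \<open>Loops\<close>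

text \<open>The registers that hold problem sizes and survive every loop; the others are
  scratch.\<close>

definition regs :: "nat \<Rightarrow> nat \<Rightarrow> registers \<Rightarrow> bool" where
  "regs n L r \<longleftrightarrow> r ''n'' = n \<and> r ''E'' = L \<and> r ''P'' = 2 ^ L"

abbreviation Incr :: "name \<Rightarrow> com" where
  "Incr v \<equiv> Set v (IAdd (Reg v) (Num 1))"

text \<open>One flat counter with row and column recovered by division, instead of nested loops:
  \<open>p\<close> is also the next free cell of the target in most uses, and the index arithmetic
  is free.\<close>

definition fill :: "iexp \<Rightarrow> iexp \<Rightarrow> com \<Rightarrow> com" where
  "fill e f c =
     Seq (Set ''p'' (Num 0))
      (While (Less (Reg ''p'') (IMul e f))
        (Seq (Set ''q'' (IDiv (Reg ''p'') f))
        (Seq (Set ''k'' (IMod (Reg ''p'') f))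
        (Seq c (Incr ''p'')))))"

lemma achieves_Set_regs:
  assumes "\<And>r. R r \<Longrightarrow> R' (r(v := ival e r))"
  shows "achieves \<phi> (good F S R) (Set v e) 0 (good F S R')"
proof (rule achieves_good_regs)
  fix r assume "R r"
  then show "achieves \<phi> (good F S ((=) r)) (Set v e) 0 (good F S R')"
    by (intro achieves_conseq[OF achieves_Set[of \<phi> F S r v e]])
      (auto simp: good_def dest!: assms)
qed

text \<open>The body may change scratch registers other than \<open>p\<close>. The transform needs
  this freedom, because its body computes a power of two in \<open>h\<close> and \<open>i\<close>;
  \<open>achieves_fill\<close> covers bodies that leave the registers alone.\<close>

lemma achieves_fill':
  assumes body: "\<And>q k r. q < B \<Longrightarrow> k < K \<Longrightarrow> regs n L r \<Longrightarrow>
      r ''p'' = q * K + k \<Longrightarrow> r ''q'' = q \<Longrightarrow> r ''k'' = k \<Longrightarrow>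
      achieves \<phi> (good F (S (q * K + k)) ((=) r)) c t
        (good F (S (Suc (q * K + k))) (\<lambda>r'. regs n L r' \<and> r' ''p'' = q * K + k))"
    and sizes: "\<And>r. regs n L r \<Longrightarrow> ival e r = B \<and> ival f r = K"
  shows "achieves \<phi> (good F (S 0) (regs n L)) (fill e f c) (B * K * t)
    (good F (S (B * K)) (regs n L))"
proof -
  define A where "A p = good F (S p) (\<lambda>r. regs n L r \<and> r ''p'' = p)" for p
  have regs_upd: "regs n L (r(v := z))" if "regs n L r" "v \<notin> {''n'', ''E'', ''P''}" for r v z
    using that by (auto simp: regs_def)
  have start: "achieves \<phi> (good F (S 0) (regs n L)) (Set ''p'' (Num 0)) 0 (A 0)"
    unfolding A_def by (rule achieves_Set_regs) (simp add: regs_upd)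
  have step: "achieves \<phi> (A p) (Seq (Set ''q'' (IDiv (Reg ''p'') f))
      (Seq (Set ''k'' (IMod (Reg ''p'') f)) (Seq c (Incr ''p'')))) t (A (Suc p))"
    if p: "p < B * K" for p
  proof -
    have K: "K > 0"
      using p by (cases K) auto
    define q k where "q = p div K" and "k = p mod K"
    have qk: "q < B" "k < K" "q * K + k = p"
      using p K by (auto simp: q_def k_def div_less_iff_less_mult)
    have s1: "achieves \<phi> (A p) (Set ''q'' (IDiv (Reg ''p'') f)) 0
        (good F (S p) (\<lambda>r. regs n L r \<and> r ''p'' = p \<and> r ''q'' = q))"
      unfolding A_def using sizes by (intro achieves_Set_regs) (simp add: regs_upd q_def)
    have s2: "achieves \<phi> (good F (S p) (\<lambda>r. regs n L r \<and> r ''p'' = p \<and> r ''q'' = q))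
        (Set ''k'' (IMod (Reg ''p'') f)) 0
        (good F (S p) (\<lambda>r. regs n L r \<and> r ''p'' = p \<and> r ''q'' = q \<and> r ''k'' = k))"
      using sizes by (intro achieves_Set_regs) (simp add: regs_upd k_def)
    have s3: "achieves \<phi>
        (good F (S p) (\<lambda>r. regs n L r \<and> r ''p'' = p \<and> r ''q'' = q \<and> r ''k'' = k)) c t
        (good F (S (Suc p)) (\<lambda>r. regs n L r \<and> r ''p'' = p))"
      using body[OF qk(1,2)] by - (rule achieves_good_regs, simp add: qk(3))
    have s4: "achieves \<phi> (good F (S (Suc p)) (\<lambda>r. regs n L r \<and> r ''p'' = p)) (Incr ''p'') 0
        (A (Suc p))"
      unfolding A_def by (intro achieves_Set_regs) (simp add: regs_upd)
    show ?thesis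
      using achieves_Seq[OF s1 achieves_Seq[OF s2 achieves_Seq[OF s3 s4]]] by simp
  qed
  have "achieves \<phi> (A 0) (While (Less (Reg ''p'') (IMul e f))
        (Seq (Set ''q'' (IDiv (Reg ''p'') f))
        (Seq (Set ''k'' (IMod (Reg ''p'') f))
        (Seq c (Incr ''p''))))) (B * K * t) (A (B * K))"
    by (rule achieves_While[where A = A, OF step]) (use sizes in \<open>auto simp: A_def good_def\<close>)
  from achieves_Seq[OF start this] show ?thesis
    unfolding fill_def by (rule achieves_conseq) (auto simp: A_def good_def)
qed

lemma achieves_fill:
  assumes "\<And>q k r. q < B \<Longrightarrow> k < K \<Longrightarrow> regs n L r \<Longrightarrow>
      r ''p'' = q * K + k \<Longrightarrow> r ''q'' = q \<Longrightarrow> r ''k'' = k \<Longrightarrow>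
      achieves \<phi> (good F (S' (q * K + k)) ((=) r)) c t (good F (S' (Suc (q * K + k))) ((=) r))"
    and "\<And>r. regs n L r \<Longrightarrow> ival e r = B \<and> ival f r = K"
    and "S' 0 = S"
  shows "achieves \<phi> (good F S (regs n L)) (fill e f c) (B * K * t)
    (good F (S' (B * K)) (regs n L))"
  unfolding assms(3)[symmetric]
  by (rule achieves_fill'[where S = S', OF _ assms(2)], rule achieves_conseq[OF assms(1)])
    (auto simp: good_def)

text \<open>An initially zero cell of an array that is never written. Adding it replaces the missing
  copy operation, and its exponential supplies the constant 1.\<close>

definition zero_cell :: cell where
  "zero_cell = Cell ''0'' (Num 0)"

text \<open>All partial sums are kept, as cells are never overwritten. A row has
  \<open>Suc K\<close> cells: it opens with the empty sum, and its last cell is the total.\<close>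

definition prefix_sum :: "nat \<Rightarrow> (nat \<Rightarrow> nat \<Rightarrow> complex) \<Rightarrow> nat \<Rightarrow> complex" where
  "prefix_sum K g p = (\<Sum>k<p mod Suc K. g (p div Suc K) k)"

text \<open>The term just added at the same position of \<open>prefix_sum\<close>, hence the shift
  by one; the filler 0 at the start of a row lets both arrays advance together.\<close>

definition prefix_term :: "nat \<Rightarrow> (nat \<Rightarrow> nat \<Rightarrow> complex) \<Rightarrow> nat \<Rightarrow> complex" where
  "prefix_term K g p =
     (if p mod Suc K = 0 then 0 else g (p div Suc K) (p mod Suc K - 1))"

definition sum_products ::
  "name \<Rightarrow> name \<Rightarrow> name \<Rightarrow> iexp \<Rightarrow> name \<Rightarrow> iexp \<Rightarrow> iexp \<Rightarrow> nat \<Rightarrow> com" where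
  "sum_products s t a e b f m K =
     fill m (Num (Suc K))
      (Cond (Less (Reg ''k'') (Num 1))
        (Seq (Add (Cell t (Reg ''p'')) zero_cell zero_cell)
             (Add (Cell s (Reg ''p'')) zero_cell zero_cell))
        (Seq (Mul (Cell t (Reg ''p'')) (Cell a e) (Cell b f))
             (Add (Cell s (Reg ''p'')) (Cell s (ISub (Reg ''p'') (Num 1))) (Cell t (Reg ''p'')))))"

lemma achieves_sum_products:
  assumes names: "s \<noteq> t" "a \<noteq> s" "a \<noteq> t" "b \<noteq> s" "b \<noteq> t" "s \<noteq> ''0''" "t \<noteq> ''0''"
    and S: "S s = 0" "S t = 0" "0 < S ''0''"
    and F: "F ''0'' 0 = 0" "F s = prefix_sum K g" "F t = prefix_term K g"
    and entries: "\<And>q k r. q < B \<Longrightarrow> k < K \<Longrightarrow> regs n L r \<Longrightarrow> r ''q'' = q \<Longrightarrow> r ''k'' = Suc k \<Longrightarrow>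
      ival e r < S a \<and> ival f r < S b \<and> F a (ival e r) * F b (ival f r) = g q k"
    and size: "\<And>r. regs n L r \<Longrightarrow> ival m r = B"
  shows "achieves \<phi> (good F S (regs n L)) (sum_products s t a e b f m K) (B * Suc K * 2)
    (good F (S(s := B * Suc K, t := B * Suc K)) (regs n L))"
  unfolding sum_products_def
proof (rule achieves_fill)
  fix q k r
  assume q: "q < B" and k: "k < Suc K" and r: "regs n L r"
    and rp: "r ''p'' = q * Suc K + k" and rq: "r ''q'' = q" and rk: "r ''k'' = k"
  define p where "p = q * Suc K + k"
  have p: "p div Suc K = q" "p mod Suc K = k"
    using k by (simp_all add: p_def del: mult_Suc_right)
  \<comment> \<open>Away from column 0 the preceding cell belongs to the same row, so the running
    sum never picks up the total of another row.\<close>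
  have pred: "(p - 1) div Suc K = q" "(p - 1) mod Suc K = k - 1" if "k \<noteq> 0"
  proof -
    have "p - 1 = q * Suc K + (k - 1)"
      using that by (simp add: p_def)
    then show "(p - 1) div Suc K = q" "(p - 1) mod Suc K = k - 1"
      using k by (simp_all del: mult_Suc_right)
  qed
  have Ft: "F t p = (if k = 0 then 0 else F a (ival e r) * F b (ival f r))"
    using entries[of q "k - 1" r] k q r rq rk by (auto simp: F p prefix_term_def)
  have Fs: "F s p = (if k = 0 then 0 else F s (p - 1) + F t p)"
    using pred by (cases k) (auto simp: F p prefix_term_def prefix_sum_def)
  have ent: "ival e r < S a" "ival f r < S b" if "k \<noteq> 0"
    using entries[of q "k - 1" r] k q r rq rk that by auto
  have Pp: "r ''p'' = p"
    by (simp add: rp p_def)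
  let ?S = "\<lambda>p. S(s := p, t := p)"
  show "achieves \<phi> (good F (?S (q * Suc K + k)) ((=) r))
      (Cond (Less (Reg ''k'') (Num 1))
        (Seq (Add (Cell t (Reg ''p'')) zero_cell zero_cell)
             (Add (Cell s (Reg ''p'')) zero_cell zero_cell))
        (Seq (Mul (Cell t (Reg ''p'')) (Cell a e) (Cell b f))
             (Add (Cell s (Reg ''p'')) (Cell s (ISub (Reg ''p'') (Num 1))) (Cell t (Reg ''p'')))))
      2 (good F (?S (Suc (q * Suc K + k))) ((=) r))"
    unfolding p_def[symmetric] zero_cell_def one_add_one[symmetric]
  proof (rule achieves_Cond; rule achieves_Seq)
    assume "tval (Less (Reg ''k'') (Num 1)) r"
    then have k: "k = 0"
      by (simp add: rk)
    show "achieves \<phi> (good F (?S p) ((=) r))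
        (Add (Cell t (Reg ''p'')) (Cell ''0'' (Num 0)) (Cell ''0'' (Num 0))) 1
        (good F (S(s := p, t := Suc p)) ((=) r))"
      by (rule achieves_Add) (use k names S F(1) Ft Pp in \<open>auto simp: fun_eq_iff\<close>)
    show "achieves \<phi> (good F (S(s := p, t := Suc p)) ((=) r))
        (Add (Cell s (Reg ''p'')) (Cell ''0'' (Num 0)) (Cell ''0'' (Num 0))) 1
        (good F (?S (Suc p)) ((=) r))"
      by (rule achieves_Add) (use k names S F(1) Fs Pp in \<open>auto simp: fun_eq_iff\<close>)
  next
    assume "\<not> tval (Less (Reg ''k'') (Num 1)) r"
    then have k: "k \<noteq> 0" "p \<noteq> 0"
      by (simp_all add: rk p_def)
    show "achieves \<phi> (good F (?S p) ((=) r)) (Mul (Cell t (Reg ''p'')) (Cell a e) (Cell b f)) 1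
        (good F (S(s := p, t := Suc p)) ((=) r))"
      by (rule achieves_Mul) (use k names S Ft Pp ent in \<open>auto simp: fun_eq_iff\<close>)
    show "achieves \<phi> (good F (S(s := p, t := Suc p)) ((=) r))
        (Add (Cell s (Reg ''p'')) (Cell s (ISub (Reg ''p'') (Num 1))) (Cell t (Reg ''p''))) 1
        (good F (?S (Suc p)) ((=) r))"
      by (rule achieves_Add) (use k names S Fs Pp in \<open>auto simp: fun_eq_iff\<close>)
  qed
qed (use size in simp, use S in \<open>simp add: fun_eq_iff\<close>)

text \<open>Index expressions have no powers. Recomputing \<open>2 ^ q\<close> from scratch for each
  cell is harmless, since register operations and tests cost nothing.\<close>

definition set_power :: com where
  "set_power =
     Seq (Set ''h'' (Num 1)) (Seq (Set ''i'' (Num 0))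
      (While (Less (Reg ''i'') (Reg ''q''))
        (Seq (Set ''h'' (IMul (Num 2) (Reg ''h''))) (Incr ''i''))))"

lemma achieves_set_power:
  "achieves \<phi> (good F S ((=) r)) set_power 0
    (good F S ((=) (r(''h'' := 2 ^ r ''q'', ''i'' := r ''q''))))"
proof -
  define A where "A k = good F S ((=) (r(''h'' := 2 ^ k, ''i'' := k)))" for k
  have 1: "achieves \<phi> (good F S ((=) r)) (Set ''h'' (Num 1)) 0 (good F S ((=) (r(''h'' := 1))))"
    by (rule achieves_Set_regs) auto
  have 2: "achieves \<phi> (good F S ((=) (r(''h'' := 1)))) (Set ''i'' (Num 0)) 0 (A 0)"
    unfolding A_def by (rule achieves_Set_regs) auto
  have "achieves \<phi> (A k) (Seq (Set ''h'' (IMul (Num 2) (Reg ''h''))) (Incr ''i'')) (0 + 0)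
      (A (Suc k))" for k
    unfolding A_def
    by (rule achieves_Seq[where B = "good F S ((=) (r(''h'' := 2 ^ Suc k, ''i'' := k)))"];
        rule achieves_Set_regs; drule sym; simp add: fun_eq_iff)
  then have "achieves \<phi> (A 0) (While (Less (Reg ''i'') (Reg ''q''))
        (Seq (Set ''h'' (IMul (Num 2) (Reg ''h''))) (Incr ''i''))) (r ''q'' * (0 + 0)) (A (r ''q''))"
    by (rule achieves_While[where A = A]) (auto simp: A_def dest!: good_regsD)
  note 3 = this
  have "achieves \<phi> (good F S ((=) r)) set_power (0 + (0 + r ''q'' * (0 + 0))) (A (r ''q''))"
    unfolding set_power_def by (rule achieves_Seq[OF 1 achieves_Seq[OF 2 3]])
  then show ?thesis
    by (simp add: A_def)
qed

definition set_sizes :: com where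
  "set_sizes =
     Seq (Set ''P'' (Num 1)) (Seq (Set ''E'' (Num 0))
      (While (Less (Reg ''P'') (IMul (Num 2) (Reg ''n'')))
        (Seq (Set ''P'' (IMul (Num 2) (Reg ''P''))) (Incr ''E''))))"

text \<open>The bound \<open>2 * n\<close> exceeds the \<open>2 * n - 1\<close> needed to avoid
  wrap-around; minimality is what limits the transform length to \<open>4 * n\<close>.\<close>

definition log_size :: "nat \<Rightarrow> nat" where
  "log_size n = (LEAST L. 2 * n \<le> 2 ^ L)"

lemma two_le_power_log_size: "2 * n \<le> 2 ^ log_size n"
  unfolding log_size_def by (rule LeastI[of _ "2 * n"]) (rule less_imp_le[OF less_exp])

lemma power_less_of_less_log_size: "k < log_size n \<Longrightarrow> 2 ^ k < 2 * n"
  unfolding log_size_def using not_less_Least by (metis not_le)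

lemma achieves_set_sizes:
  "achieves \<phi> (good F S (\<lambda>r. r ''n'' = n)) set_sizes 0 (good F S (regs n (log_size n)))"
proof -
  define A where "A k = good F S (regs n k)" for k
  have 1: "achieves \<phi> (good F S (\<lambda>r. r ''n'' = n)) (Set ''P'' (Num 1)) 0
      (good F S (\<lambda>r. r ''n'' = n \<and> r ''P'' = 1))"
    by (rule achieves_Set_regs) auto
  have 2: "achieves \<phi> (good F S (\<lambda>r. r ''n'' = n \<and> r ''P'' = 1)) (Set ''E'' (Num 0)) 0 (A 0)"
    unfolding A_def regs_def by (rule achieves_Set_regs) auto
  have "achieves \<phi> (A k) (Seq (Set ''P'' (IMul (Num 2) (Reg ''P''))) (Incr ''E'')) (0 + 0)
      (A (Suc k))" for k
    unfolding A_def regs_def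
    by (rule achieves_Seq[where
          B = "good F S (\<lambda>r. r ''n'' = n \<and> r ''E'' = k \<and> r ''P'' = 2 ^ Suc k)"];
        rule achieves_Set_regs) auto
  then have "achieves \<phi> (A 0) (While (Less (Reg ''P'') (IMul (Num 2) (Reg ''n'')))
      (Seq (Set ''P'' (IMul (Num 2) (Reg ''P''))) (Incr ''E''))) (log_size n * (0 + 0))
      (A (log_size n))"
    by (rule achieves_While[where A = A])
      (use two_le_power_log_size[of n] power_less_of_less_log_size in
        \<open>auto simp: A_def good_def regs_def not_less\<close>)
  note 3 = this
  have "achieves \<phi> (good F S (\<lambda>r. r ''n'' = n)) set_sizes (0 + (0 + log_size n * (0 + 0)))
      (A (log_size n))"
    unfolding set_sizes_def by (rule achieves_Seq[OF 1 achieves_Seq[OF 2 3]])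
  then show ?thesis
    by (simp add: A_def)
qed

section \<open>Programs\<close>

text \<open>The address \<open>fft_source\<close>, with \<open>h\<close> holding
  \<open>2 ^ q\<close>, moved into the block of round \<open>q - 1\<close>. It is used only for
  \<open>q > 0\<close>.\<close>

definition source_expr :: "iexp \<Rightarrow> nat \<Rightarrow> iexp" where
  "source_expr T c =
     IAdd (IMul (ISub (Reg ''q'') (Num 1)) T)
      (IAdd (IMul (IAdd (IDiv (Reg ''k'') (Reg ''h'')) (IMul (Num c) (IDiv T (Reg ''h''))))
                  (IDiv (Reg ''h'') (Num 2)))
            (IMod (IMod (Reg ''k'') (Reg ''h'')) (IDiv (Reg ''h'') (Num 2))))"

text \<open>All rounds are stored one after another, each in a block of length \<open>T\<close>; the
  finished transforms form block \<open>L\<close>.\<close>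

definition fft_array :: "nat \<Rightarrow> (nat \<Rightarrow> complex) \<Rightarrow> nat \<Rightarrow> complex" where
  "fft_array T u p = fft_round T u (p div T) (p mod T)"

definition fft_roots :: "nat \<Rightarrow> nat \<Rightarrow> complex" where
  "fft_roots T p = unity_root (2 ^ (p div T)) ((p mod T) mod 2 ^ (p div T))"

definition fft_terms :: "nat \<Rightarrow> (nat \<Rightarrow> complex) \<Rightarrow> nat \<Rightarrow> complex" where
  "fft_terms T u p =
     (if p < T then 0
      else fft_roots T p * fft_round T u (p div T - 1) (fft_source T (p div T) (p mod T) 1))"

text \<open>Three operations per entry: a root, a product and a sum. Round 0 copies the input and
  computes its root as well, so that the three arrays grow in step.\<close>

definition fft :: "name \<Rightarrow> name \<Rightarrow> name \<Rightarrow> name \<Rightarrow> iexp \<Rightarrow> com" where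
  "fft u a w v T =
     fill (IAdd (Reg ''E'') (Num 1)) T
      (Seq set_power
      (Seq (Root (Cell w (Reg ''p'')) (Reg ''h'') (IMod (Reg ''k'') (Reg ''h'')))
      (Cond (Less (Reg ''q'') (Num 1))
        (Seq (Add (Cell v (Reg ''p'')) zero_cell zero_cell)
             (Add (Cell a (Reg ''p'')) (Cell u (Reg ''k'')) zero_cell))
        (Seq (Mul (Cell v (Reg ''p'')) (Cell w (Reg ''p'')) (Cell a (source_expr T 1)))
             (Add (Cell a (Reg ''p'')) (Cell a (source_expr T 0)) (Cell v (Reg ''p'')))))))"

lemma achieves_fft:
  assumes names: "a \<noteq> w" "a \<noteq> v" "w \<noteq> v" "u \<notin> {a, w, v}" "''0'' \<notin> {a, w, v}"
    and S: "S a = 0" "S w = 0" "S v = 0" "T \<le> S u" "0 < S ''0''"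
    and F: "F ''0'' 0 = 0" "F a = fft_array T (F u)" "F w = fft_roots T" "F v = fft_terms T (F u)"
    and T: "2 ^ L dvd T" "\<And>r. regs n L r \<Longrightarrow> ival e r = T"
  shows "achieves \<phi> (good F S (regs n L)) (fft u a w v e) (Suc L * T * 3)
    (good F (S(a := Suc L * T, w := Suc L * T, v := Suc L * T)) (regs n L))"
proof -
  let ?S = "\<lambda>p. S(a := p, w := p, v := p)"
  have S0: "?S 0 = S"
    using S by (simp add: fun_eq_iff)
  show ?thesis
    unfolding fft_def
  proof (rule achieves_fill'[where S = ?S, unfolded S0])
    fix q k r
    assume q: "q < Suc L" and k: "k < T" and r: "regs n L r"
      and rp: "r ''p'' = q * T + k" and rq: "r ''q'' = q" and rk: "r ''k'' = k"
    define p where "p = q * T + k"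
    define r1 where "r1 = r(''h'' := 2 ^ q, ''i'' := q)"
    have r1: "r1 ''p'' = p" "r1 ''q'' = q" "r1 ''k'' = k" "r1 ''h'' = 2 ^ q" "regs n L r1"
      using r rp rq rk by (simp_all add: r1_def regs_def p_def)
    have p: "p div T = q" "p mod T = k"
      using k by (simp_all add: p_def)
    have pT: "p < T \<longleftrightarrow> q = 0"
      using k by (cases q) (auto simp: p_def)
    have source: "ival (source_expr e c) r1 = (q - 1) * T + fft_source T q k c" if "q \<noteq> 0" for c
      using that T(2)[OF r1(5)] r1
      by (cases q) (simp_all add: source_expr_def fft_source_def)
    have dvd: "2 ^ q dvd T"
      using T(1) q by (meson le_imp_power_dvd dvd_trans less_Suc_eq_le)
    have less: "fft_source T q k c < T" if "q \<noteq> 0" "c < 2" for c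
      using fft_source_less[of "q - 1" T k c] that k dvd by simp
    \<comment> \<open>Round \<open>q\<close> reads from block \<open>q - 1\<close> only, and that
      block is complete when block \<open>q\<close> is begun.\<close>
    have less': "(q - 1) * T + fft_source T q k c < p" if "q \<noteq> 0" "c < 2" for c
    proof -
      have "(q - 1) * T + fft_source T q k c < q * T"
        using less[OF that] that(1) by (cases q) auto
      then show ?thesis by (simp add: p_def)
    qed
    have Fa: "F a ((q - 1) * T + fft_source T q k c) =
        fft_round T (F u) (q - 1) (fft_source T q k c)" if "q \<noteq> 0" "c < 2" for c
      using less[OF that] by (simp add: F fft_array_def)
    have Fw: "F w p = unity_root (2 ^ q) (k mod 2 ^ q)"
      by (simp add: F fft_roots_def p)
    have Fv: "F v p = (if q = 0 then 0 else F w p * F a ((q - 1) * T + fft_source T q k 1))"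
      using pT Fa[of 1] by (auto simp: F(3,4) fft_terms_def p)
    have Fa_p: "F a p =
        (if q = 0 then F u k else F a ((q - 1) * T + fft_source T q k 0) + F v p)"
    proof (cases q)
      case 0
      then show ?thesis
        by (simp add: F fft_array_def p fft_round_0)
    next
      case (Suc s)
      have "F a p = fft_round T (F u) (Suc s) k"
        by (simp add: F fft_array_def p Suc)
      also have "\<dots> = fft_round T (F u) s (fft_source T q k 0) +
          unity_root (2 ^ q) (k mod 2 ^ q) * fft_round T (F u) s (fft_source T q k 1)"
        using fft_round_Suc[of s T "F u" k] dvd by (simp only: Suc)
      finally show ?thesis
        using Suc Fa[of 0] Fa[of 1] Fw by (simp add: Fv)
    qed
    have power: "achieves \<phi> (good F (?S p) ((=) r)) set_power 0 (good F (?S p) ((=) r1))"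
      using achieves_set_power[of \<phi> F "?S p" r] by (simp add: r1_def rq)
    have root: "achieves \<phi> (good F (?S p) ((=) r1))
        (Root (Cell w (Reg ''p'')) (Reg ''h'') (IMod (Reg ''k'') (Reg ''h''))) 1
        (good F (S(a := p, w := Suc p, v := p)) ((=) r1))"
      by (rule achieves_Root) (use names r1 Fw in \<open>auto simp: fun_eq_iff\<close>)
    have butterfly: "achieves \<phi> (good F (S(a := p, w := Suc p, v := p)) ((=) r1))
      (Cond (Less (Reg ''q'') (Num 1))
        (Seq (Add (Cell v (Reg ''p'')) zero_cell zero_cell)
             (Add (Cell a (Reg ''p'')) (Cell u (Reg ''k'')) zero_cell))
        (Seq (Mul (Cell v (Reg ''p'')) (Cell w (Reg ''p'')) (Cell a (source_expr e 1)))
             (Add (Cell a (Reg ''p'')) (Cell a (source_expr e 0)) (Cell v (Reg ''p''))))) (1 + 1)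
        (good F (?S (Suc p)) ((=) r1))"
      unfolding zero_cell_def
    proof (rule achieves_Cond; rule achieves_Seq)
      assume "tval (Less (Reg ''q'') (Num 1)) r1"
      then have q0: "q = 0"
        by (simp add: r1)
      show "achieves \<phi> (good F (S(a := p, w := Suc p, v := p)) ((=) r1))
          (Add (Cell v (Reg ''p'')) (Cell ''0'' (Num 0)) (Cell ''0'' (Num 0))) 1
          (good F (S(a := p, w := Suc p, v := Suc p)) ((=) r1))"
        by (rule achieves_Add) (use names r1 Fv q0 S F(1) in \<open>auto simp: fun_eq_iff\<close>)
      show "achieves \<phi> (good F (S(a := p, w := Suc p, v := Suc p)) ((=) r1))
          (Add (Cell a (Reg ''p'')) (Cell u (Reg ''k'')) (Cell ''0'' (Num 0))) 1
          (good F (?S (Suc p)) ((=) r1))"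
        by (rule achieves_Add) (use names r1 Fa_p q0 S F(1) k in \<open>auto simp: fun_eq_iff\<close>)
    next
      assume "\<not> tval (Less (Reg ''q'') (Num 1)) r1"
      then have q0: "q \<noteq> 0"
        by (simp add: r1)
      show "achieves \<phi> (good F (S(a := p, w := Suc p, v := p)) ((=) r1))
          (Mul (Cell v (Reg ''p'')) (Cell w (Reg ''p'')) (Cell a (source_expr e 1))) 1
          (good F (S(a := p, w := Suc p, v := Suc p)) ((=) r1))"
        by (rule achieves_Mul)
          (use names r1(1) Fv q0 source[OF q0] less'[OF q0] in \<open>auto simp: fun_eq_iff\<close>)
      show "achieves \<phi> (good F (S(a := p, w := Suc p, v := Suc p)) ((=) r1))
          (Add (Cell a (Reg ''p'')) (Cell a (source_expr e 0)) (Cell v (Reg ''p''))) 1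
          (good F (?S (Suc p)) ((=) r1))"
        by (rule achieves_Add)
          (use names r1(1) Fa_p q0 source[OF q0] less'[OF q0] in \<open>auto simp: fun_eq_iff\<close>)
    qed
    show "achieves \<phi> (good F (?S (q * T + k)) ((=) r))
      (Seq set_power
      (Seq (Root (Cell w (Reg ''p'')) (Reg ''h'') (IMod (Reg ''k'') (Reg ''h'')))
      (Cond (Less (Reg ''q'') (Num 1))
        (Seq (Add (Cell v (Reg ''p'')) zero_cell zero_cell)
             (Add (Cell a (Reg ''p'')) (Cell u (Reg ''k'')) zero_cell))
        (Seq (Mul (Cell v (Reg ''p'')) (Cell w (Reg ''p'')) (Cell a (source_expr e 1)))
             (Add (Cell a (Reg ''p'')) (Cell a (source_expr e 0)) (Cell v (Reg ''p'')))))))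
      3 (good F (?S (Suc (q * T + k))) (\<lambda>r'. regs n L r' \<and> r' ''p'' = q * T + k))"
      unfolding p_def[symmetric]
      by (rule achieves_conseq[OF achieves_Seq[OF power achieves_Seq[OF root butterfly]]])
        (use r1 in \<open>auto simp: good_def\<close>)
  qed (use T(2) in \<open>simp add: regs_def\<close>)
qed

lemma achieves_fill_array:
  assumes "\<And>q k r. q < B \<Longrightarrow> k < K \<Longrightarrow> regs n L r \<Longrightarrow>
      r ''p'' = q * K + k \<Longrightarrow> r ''q'' = q \<Longrightarrow> r ''k'' = k \<Longrightarrow>
      achieves \<phi> (good F (S(a := q * K + k)) ((=) r)) c t (good F (S(a := Suc (q * K + k))) ((=) r))"
    and "\<And>r. regs n L r \<Longrightarrow> ival e r = B \<and> ival f r = K"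
    and "S a = 0"
  shows "achieves \<phi> (good F S (regs n L)) (fill e f c) (B * K * t)
    (good F (S(a := B * K)) (regs n L))"
  by (rule achieves_fill[where S' = "\<lambda>p. S(a := p)"]) (use assms in \<open>simp_all add: fun_eq_iff\<close>)

text \<open>By minimality of \<open>log_size n\<close>, half of the power is still below
  \<open>2 * n\<close>.\<close>

lemma power_log_size_le:
  assumes "n > 0"
  shows "2 ^ log_size n \<le> 4 * n"
proof (cases "log_size n")
  case (Suc k)
  then have "2 ^ k < 2 * n"
    by (intro power_less_of_less_log_size) simp
  then show ?thesis
    by (simp add: Suc)
qed (use assms in simp)

definition row_products :: "nat \<Rightarrow> name \<Rightarrow> name \<Rightarrow> name \<Rightarrow> com" where
  "row_products d W s t =
     sum_products s t
       ''x'' (IAdd (IMul (IDiv (Reg ''q'') (Num d)) (Num d)) (ISub (Reg ''k'') (Num 1)))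
       W (IAdd (IMul (ISub (Reg ''k'') (Num 1)) (Num d)) (IMod (Reg ''q'') (Num d)))
       (IMul (Reg ''n'') (Num d)) d"

text \<open>The totals in \<open>s\<close> are \<open>Suc d\<close> cells apart, whereas
  \<open>Feat\<close> reads \<open>d\<close> consecutive cells; the middle loop packs them.\<close>

definition feature_rows :: "nat \<Rightarrow> nat \<Rightarrow> name \<Rightarrow> name \<Rightarrow> name \<Rightarrow> name \<Rightarrow> name \<Rightarrow> com" where
  "feature_rows d m W s t y f =
     Seq (row_products d W s t)
    (Seq (fill (Reg ''n'') (Num d)
           (Add (Cell y (Reg ''p''))
             (Cell s (IAdd (IMul (Reg ''p'') (Num (Suc d))) (Num d))) zero_cell))
         (fill (Reg ''n'') (Num 1)
           (Feat (Cell f (IMul (Reg ''p'') (Num m))) (Cell y (IMul (Reg ''p'') (Num d))))))"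

definition augment_values :: "nat \<Rightarrow> com" where
  "augment_values d =
     fill (Reg ''n'') (Num (Suc d))
       (Cond (Less (Reg ''k'') (Num d))
         (Add (Cell ''v'' (Reg ''p''))
           (Cell ''sV'' (IAdd (IMul (IAdd (IMul (Reg ''q'') (Num d)) (Reg ''k'')) (Num (Suc d)))
             (Num d))) zero_cell)
         (Exp (Cell ''v'' (Reg ''p'')) zero_cell))"

text \<open>Entry \<open>q\<close> of sequence \<open>k\<close> goes to position
  \<open>q * Q + k\<close>. The last sequence is the kernel in reversed order: its entry
  \<open>q\<close> belongs to the offset \<open>n - 1 - q\<close>, which the input stores at
  \<open>2 * n - 2 - q\<close>.\<close>

definition interleave :: "nat \<Rightarrow> nat \<Rightarrow> com" where
  "interleave d m =
     fill (Reg ''P'') (Num (Suc (m * Suc d)))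
       (Cond (Less (Reg ''k'') (Num (m * Suc d)))
         (Cond (Less (Reg ''q'') (Reg ''n''))
           (Mul (Cell ''u'' (Reg ''p''))
             (Cell ''fK'' (IAdd (IMul (Reg ''q'') (Num m)) (IDiv (Reg ''k'') (Num (Suc d)))))
             (Cell ''v'' (IAdd (IMul (Reg ''q'') (Num (Suc d)))
               (IMod (Reg ''k'') (Num (Suc d))))))
           (Add (Cell ''u'' (Reg ''p'')) zero_cell zero_cell))
         (Cond (Less (Reg ''q'') (ISub (IMul (Num 2) (Reg ''n'')) (Num 1)))
           (Exp (Cell ''u'' (Reg ''p''))
             (Cell ''b'' (ISub (ISub (IMul (Num 2) (Reg ''n'')) (Num 2)) (Reg ''q''))))
           (Add (Cell ''u'' (Reg ''p'')) zero_cell zero_cell)))"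

definition batch_size :: "nat \<Rightarrow> nat \<Rightarrow> iexp" where
  "batch_size d m = IMul (Num (Suc (m * Suc d))) (Reg ''P'')"

text \<open>Spectra are read from contiguous blocks, but the products are written interleaved again,
  as the second transform expects them.\<close>

definition multiply_spectra :: "nat \<Rightarrow> nat \<Rightarrow> com" where
  "multiply_spectra d m =
     fill (Reg ''P'') (Num (Suc (m * Suc d)))
       (Mul (Cell ''y'' (Reg ''p''))
         (Cell ''A'' (IAdd (IMul (Reg ''E'') (batch_size d m))
           (IAdd (IMul (Reg ''k'') (Reg ''P'')) (Reg ''q''))))
         (Cell ''A'' (IAdd (IMul (Reg ''E'') (batch_size d m))
           (IAdd (IMul (Num (m * Suc d)) (Reg ''P'')) (Reg ''q'')))))"

definition mix_features :: "nat \<Rightarrow> nat \<Rightarrow> com" where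
  "mix_features d m =
     sum_products ''sZ'' ''tZ''
       ''fQ'' (IAdd (IMul (IDiv (Reg ''q'') (Num (Suc d))) (Num m)) (ISub (Reg ''k'') (Num 1)))
       ''B'' (IAdd (IMul (Reg ''E'') (batch_size d m))
         (IAdd (IMul (IAdd (IMul (ISub (Reg ''k'') (Num 1)) (Num (Suc d)))
                           (IMod (Reg ''q'') (Num (Suc d)))) (Reg ''P''))
               (ISub (Reg ''P'') (ISub (IAdd (IDiv (Reg ''q'') (Num (Suc d))) (Reg ''n''))
                 (Num 1)))))
       (IMul (Reg ''n'') (Num (Suc d))) m"

definition normalize_outputs :: "nat \<Rightarrow> nat \<Rightarrow> com" where
  "normalize_outputs d m =
     fill (Reg ''n'') (Num d)
       (Div (Cell ''z'' (Reg ''p''))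
         (Cell ''sZ'' (IAdd (IMul (IAdd (IMul (Reg ''q'') (Num (Suc d))) (Reg ''k''))
           (Num (Suc m))) (Num m)))
         (Cell ''sZ'' (IAdd (IMul (IAdd (IMul (Reg ''q'') (Num (Suc d))) (Num d))
           (Num (Suc m))) (Num m))))"

definition attention_program :: "nat \<Rightarrow> nat \<Rightarrow> com" where
  "attention_program d m =
     Seq set_sizes
    (Seq (feature_rows d m ''WQ'' ''sQ'' ''tQ'' ''xQ'' ''fQ'')
    (Seq (feature_rows d m ''WK'' ''sK'' ''tK'' ''xK'' ''fK'')
    (Seq (row_products d ''WV'' ''sV'' ''tV'')
    (Seq (augment_values d)
    (Seq (interleave d m)
    (Seq (fft ''u'' ''A'' ''Aw'' ''Av'' (batch_size d m))
    (Seq (multiply_spectra d m)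
    (Seq (fft ''y'' ''B'' ''Bw'' ''Bv'' (batch_size d m))
    (Seq (mix_features d m)
         (normalize_outputs d m))))))))))"

section \<open>Contents of the arrays\<close>

lemma sum_coord: "(\<Sum>k<CARD('k). f (coord k :: 'k::finite)) = (\<Sum>i\<in>UNIV. f i)"
proof -
  have "bij_betw (coord :: nat \<Rightarrow> 'k) {..<CARD('k)} UNIV"
    using bij_betw_from_nat_into_finite[of "UNIV :: 'k set"]
    by (simp add: coord_def[abs_def])
  then show ?thesis
    by (rule sum.reindex_bij_betw)
qed

lemma sum_atLeast1_atMost: "(\<Sum>j = 1..n. f j) = (\<Sum>j<n. f (Suc j))"
  for f :: "nat \<Rightarrow> 'a::comm_monoid_add"
  by (simp add: sum.atLeast1_atMost_eq)

lemma prefix_sum_total: "prefix_sum K g (q * Suc K + K) = (\<Sum>k<K. g q k)"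
proof -
  have "(q * Suc K + K) div Suc K = q" "(q * Suc K + K) mod Suc K = K"
    by (simp_all del: mult_Suc_right)
  then show ?thesis
    unfolding prefix_sum_def by (simp only:)
qed

context
  fixes \<phi> :: "real ^ 'd \<Rightarrow> real ^ 'm" and n :: nat and x :: "nat \<Rightarrow> real ^ 'd"
    and WQ WK WV :: "real ^ 'd ^ 'd" and b :: "int \<Rightarrow> real"
    and d m :: nat
  assumes d_eq: "d = CARD('d)" and m_eq: "m = CARD('m)"
begin

definition L :: nat where "L = log_size n"
definition Q :: nat where "Q = Suc (m * Suc d)"
definition T :: nat where "T = Q * 2 ^ L"

definition x_cells :: "nat \<Rightarrow> complex" where
  "x_cells p = (if p < n * d
     then complex_of_real (x (p div d + 1) $ coord (p mod d)) else 0)"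

definition b_cells :: "nat \<Rightarrow> complex" where
  "b_cells p = (if p < 2 * n - 1 then complex_of_real (b (int p - (int n - 1))) else 0)"

definition row_term :: "real ^ 'd ^ 'd \<Rightarrow> nat \<Rightarrow> nat \<Rightarrow> complex" where
  "row_term W q k =
     complex_of_real (x (q div d + 1) $ coord k) * complex_of_real (W $ coord k $ coord (q mod d))"

definition row_cells :: "real ^ 'd ^ 'd \<Rightarrow> nat \<Rightarrow> complex" where
  "row_cells W p = complex_of_real ((x (p div d + 1) v* W) $ coord (p mod d))"

definition feature_cells :: "real ^ 'd ^ 'd \<Rightarrow> nat \<Rightarrow> complex" where
  "feature_cells W p = complex_of_real (\<phi> (x (p div m + 1) v* W) $ coord (p mod m))"

text \<open>The values \<open>x\<^sub>j W\<^sup>V\<close> with an additional coordinate \<open>1\<close>, which produces the denominators.\<close>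

definition value_cells :: "nat \<Rightarrow> complex" where
  "value_cells p = (if p mod Suc d < d
     then complex_of_real ((x (p div Suc d + 1) v* WV) $ coord (p mod Suc d)) else 1)"

text \<open>
  Sequence \<open>m * Suc d\<close> is the convolution kernel, with \<open>exp b\<^sub>l\<close> at position \<open>n - 1 - l\<close>.
\<close>

definition sequence :: "nat \<Rightarrow> nat \<Rightarrow> complex" where
  "sequence c j =
     (if c < m * Suc d
      then if j < n
        then feature_cells WK (j * m + c div Suc d) * value_cells (j * Suc d + c mod Suc d) else 0
      else if j < 2 * n - 1 then exp (complex_of_real (b (int n - 1 - int j))) else 0)"

definition batch_cells :: "nat \<Rightarrow> complex" where
  "batch_cells p = sequence (p mod Q) (p div Q)"

definition product_cells :: "nat \<Rightarrow> complex" where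
  "product_cells p =
     fft_array T batch_cells (L * T + ((p mod Q) * 2 ^ L + p div Q)) *
     fft_array T batch_cells (L * T + ((m * Suc d) * 2 ^ L + p div Q))"

text \<open>Row \<open>q\<close> encodes a position \<open>i = q div Suc d\<close> and a value
  coordinate. Since two forward transforms reverse the order, coefficient \<open>i + n - 1\<close>
  of the convolution sits at frequency \<open>2 ^ L - (i + n - 1)\<close>.\<close>

definition mix_term :: "nat \<Rightarrow> nat \<Rightarrow> complex" where
  "mix_term q a =
     feature_cells WQ ((q div Suc d) * m + a) *
     fft_array T product_cells
       (L * T + ((a * Suc d + q mod Suc d) * 2 ^ L + (2 ^ L - (q div Suc d + n - 1))))"

definition output_cells :: "nat \<Rightarrow> complex" where
  "output_cells p =
     (\<Sum>a<m. mix_term ((p div d) * Suc d + p mod d) a) / (\<Sum>a<m. mix_term ((p div d) * Suc d + d) a)"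

definition cells :: arrays where
  "cells = (\<lambda>_ _. 0)
     (''x'' := x_cells, ''WQ'' := mat_entries WQ, ''WK'' := mat_entries WK,
      ''WV'' := mat_entries WV, ''b'' := b_cells,
      ''sQ'' := prefix_sum d (row_term WQ), ''tQ'' := prefix_term d (row_term WQ),
      ''sK'' := prefix_sum d (row_term WK), ''tK'' := prefix_term d (row_term WK),
      ''sV'' := prefix_sum d (row_term WV), ''tV'' := prefix_term d (row_term WV),
      ''xQ'' := row_cells WQ, ''xK'' := row_cells WK,
      ''fQ'' := feature_cells WQ, ''fK'' := feature_cells WK,
      ''v'' := value_cells, ''u'' := batch_cells,
      ''A'' := fft_array T batch_cells, ''Aw'' := fft_roots T, ''Av'' := fft_terms T batch_cells,
      ''y'' := product_cells,
      ''B'' := fft_array T product_cells, ''Bw'' := fft_roots T, ''Bv'' := fft_terms T product_cells,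
      ''sZ'' := prefix_sum m mix_term, ''tZ'' := prefix_term m mix_term,
      ''z'' := output_cells)"

lemma cells_simps [simp]:
  "cells ''0'' p = 0"
  "cells ''x'' = x_cells" "cells ''WQ'' = mat_entries WQ" "cells ''WK'' = mat_entries WK"
  "cells ''WV'' = mat_entries WV" "cells ''b'' = b_cells"
  "cells ''sQ'' = prefix_sum d (row_term WQ)" "cells ''tQ'' = prefix_term d (row_term WQ)"
  "cells ''sK'' = prefix_sum d (row_term WK)" "cells ''tK'' = prefix_term d (row_term WK)"
  "cells ''sV'' = prefix_sum d (row_term WV)" "cells ''tV'' = prefix_term d (row_term WV)"
  "cells ''xQ'' = row_cells WQ" "cells ''xK'' = row_cells WK"
  "cells ''fQ'' = feature_cells WQ" "cells ''fK'' = feature_cells WK"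
  "cells ''v'' = value_cells" "cells ''u'' = batch_cells"
  "cells ''A'' = fft_array T batch_cells" "cells ''Aw'' = fft_roots T"
  "cells ''Av'' = fft_terms T batch_cells" "cells ''y'' = product_cells"
  "cells ''B'' = fft_array T product_cells" "cells ''Bw'' = fft_roots T"
  "cells ''Bv'' = fft_terms T product_cells"
  "cells ''sZ'' = prefix_sum m mix_term" "cells ''tZ'' = prefix_term m mix_term"
  "cells ''z'' = output_cells"
  by (simp_all add: cells_def)

section \<open>The pieces of the program produce the prescribed contents\<close>

lemma sum_coord_d: "(\<Sum>k<d. f (coord k :: 'd)) = (\<Sum>i\<in>UNIV. f i)"
  unfolding d_eq by (rule sum_coord)

lemma sum_coord_m: "(\<Sum>k<m. f (coord k :: 'm)) = (\<Sum>i\<in>UNIV. f i)"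
  unfolding m_eq by (rule sum_coord)

lemmas mat_entries_d = mat_entries_def[where 'd = 'd, folded d_eq]

lemmas achieves_Feat_dm = achieves_Feat[where \<phi> = \<phi>, folded d_eq m_eq]

lemma row_term_sum: "(\<Sum>k<d. row_term W q k) = row_cells W q"
  using sum_coord_d[of "\<lambda>k. complex_of_real (x (q div d + 1) $ k) *
    complex_of_real (W $ k $ coord (q mod d))"]
  by (simp add: row_term_def row_cells_def vector_matrix_mult_def mult.commute)

lemma achieves_row_products:
  assumes "s \<noteq> t" "s \<notin> {''x'', W, ''0''}" "t \<notin> {''x'', W, ''0''}"
    and "S s = 0" "S t = 0" "0 < S ''0''" "S ''x'' = n * d" "S W = d * d"
    and "cells s = prefix_sum d (row_term M)" "cells t = prefix_term d (row_term M)"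
    and "cells W = mat_entries M"
  shows "achieves \<phi> (good cells S (regs n L)) (row_products d W s t) (n * d * Suc d * 2)
    (good cells (S(s := n * d * Suc d, t := n * d * Suc d)) (regs n L))"
  unfolding row_products_def
proof (rule achieves_sum_products[where g = "row_term M"])
  fix q k r
  assume q: "q < n * d" and k: "k < d" and r: "regs n L r" "r ''q'' = q" "r ''k'' = Suc k"
  have "q div d < n"
    using q by (rule less_mult_imp_div_less)
  then have 1: "q div d * d + k < n * d"
    using k by (rule flat_less)
  have 2: "k * d + q mod d < d * d"
    using k by (intro flat_less) simp_all
  show "ival (IAdd (IMul (IDiv (Reg ''q'') (Num d)) (Num d)) (ISub (Reg ''k'') (Num 1))) r < S ''x'' \<and>
       ival (IAdd (IMul (ISub (Reg ''k'') (Num 1)) (Num d)) (IMod (Reg ''q'') (Num d))) r < S W \<and>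
       cells ''x'' (ival (IAdd (IMul (IDiv (Reg ''q'') (Num d)) (Num d)) (ISub (Reg ''k'') (Num 1))) r) *
       cells W (ival (IAdd (IMul (ISub (Reg ''k'') (Num 1)) (Num d)) (IMod (Reg ''q'') (Num d))) r) =
       row_term M q k"
    using assms 1 2 k r by (simp add: x_cells_def mat_entries_d row_term_def)
qed (use assms in \<open>auto simp: regs_def\<close>)

lemma achieves_feature_rows:
  assumes "distinct [''0'', ''x'', W, s, t, y, f]"
    and "S s = 0" "S t = 0" "S y = 0" "S f = 0" "0 < S ''0''" "S ''x'' = n * d" "S W = d * d"
    and "cells s = prefix_sum d (row_term M)" "cells t = prefix_term d (row_term M)"
    and "cells W = mat_entries M" "cells y = row_cells M" "cells f = feature_cells M"
  shows "achieves \<phi> (good cells S (regs n L)) (feature_rows d m W s t y f)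
    (n * d * Suc d * 2 + (n * d * 1 + n * 1 * 1))
    (good cells (S(s := n * d * Suc d, t := n * d * Suc d, y := n * d, f := n * m)) (regs n L))"
  unfolding feature_rows_def
proof (intro achieves_Seq)
  let ?S1 = "S(s := n * d * Suc d, t := n * d * Suc d)"
  let ?S2 = "?S1(y := n * d)"
  show "achieves \<phi> (good cells S (regs n L)) (row_products d W s t) (n * d * Suc d * 2)
      (good cells ?S1 (regs n L))"
    by (rule achieves_row_products) (use assms in auto)
  show "achieves \<phi> (good cells ?S1 (regs n L))
      (fill (Reg ''n'') (Num d)
        (Add (Cell y (Reg ''p''))
          (Cell s (IAdd (IMul (Reg ''p'') (Num (Suc d))) (Num d))) zero_cell)) (n * d * 1)
      (good cells ?S2 (regs n L))"
  proof (rule achieves_fill_array)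
    fix q k r
    assume q: "q < n" "k < d" and r: "regs n L r" "r ''p'' = q * d + k"
    have "q * d + k < n * d"
      using q by (rule flat_less)
    then have "(q * d + k) * Suc d + d < n * d * Suc d"
      by (rule flat_less) simp
    then show "achieves \<phi> (good cells (?S1(y := q * d + k)) ((=) r))
        (Add (Cell y (Reg ''p''))
          (Cell s (IAdd (IMul (Reg ''p'') (Num (Suc d))) (Num d))) zero_cell) 1
        (good cells (?S1(y := Suc (q * d + k))) ((=) r))"
      unfolding zero_cell_def
      by - (rule achieves_Add,
        use assms r in \<open>auto simp: prefix_sum_total row_term_sum simp del: mult_Suc_right\<close>)
  qed (use assms in \<open>auto simp: regs_def\<close>)
  show "achieves \<phi> (good cells ?S2 (regs n L))
      (fill (Reg ''n'') (Num 1)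
        (Feat (Cell f (IMul (Reg ''p'') (Num m))) (Cell y (IMul (Reg ''p'') (Num d))))) (n * 1 * 1)
      (good cells (?S2(f := n * m)) (regs n L))"
  \<comment> \<open>The lengths are scaled by \<open>m\<close> because each round fills
    \<open>m\<close> cells at once; this is why \<open>achieves_fill_array\<close> does not fit
    here.\<close>
  proof (rule achieves_conseq[OF achieves_fill[where S' = "\<lambda>p. ?S2(f := p * m)" and B = n and K = 1
          and t = 1 and S = ?S2]])
    fix q k r
    assume q: "q < n" and k: "k < (1 :: nat)" and r: "regs n L r" "r ''p'' = q * 1 + k"
    have "Suc q * d \<le> n * d"
      using q by (intro mult_le_mono1) simp
    then have 1: "q * d + d \<le> n * d"
      by simp
    have "(\<lambda>p. ?S2(f := p * m)) (Suc (q * 1 + k)) =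
        (?S2(f := (q * 1 + k) * m))(f := (?S2(f := (q * 1 + k) * m)) f + m)"
      using k by (simp add: add.commute)
    then show "achieves \<phi> (good cells (?S2(f := (q * 1 + k) * m)) ((=) r))
        (Feat (Cell f (IMul (Reg ''p'') (Num m))) (Cell y (IMul (Reg ''p'') (Num d)))) 1
        (good cells (?S2(f := Suc (q * 1 + k) * m)) ((=) r))"
      using k 1 assms r
      by (simp only:) (rule achieves_Feat_dm[where v = "x (q + 1) v* M"];
        simp add: row_cells_def feature_cells_def)
  qed (use assms in \<open>auto simp: regs_def fun_eq_iff\<close>)
qed

lemma achieves_augment_values:
  assumes "S ''v'' = 0" "0 < S ''0''" "S ''sV'' = n * d * Suc d"
  shows "achieves \<phi> (good cells S (regs n L)) (augment_values d) (n * Suc d * 1)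
    (good cells (S(''v'' := n * Suc d)) (regs n L))"
  unfolding augment_values_def
proof (rule achieves_fill_array)
  fix q k r
  assume q: "q < n" and k: "k < Suc d" and r: "regs n L r"
    and reg: "r ''p'' = q * Suc d + k" "r ''q'' = q" "r ''k'' = k"
  define p where "p = q * Suc d + k"
  have p: "p div Suc d = q" "p mod Suc d = k"
    using k unfolding p_def by (rule flat_div, rule flat_mod)
  have less: "(q * d + k) * Suc d + d < n * d * Suc d" if "k < d"
    using flat_less[OF flat_less[OF q that], of d "Suc d"] by simp
  \<comment> \<open>The appended coordinate 1 is obtained as \<open>exp 0\<close>.\<close>
  have val: "value_cells p =
      (if k < d then prefix_sum d (row_term WV) ((q * d + k) * Suc d + d) else exp 0)"
    unfolding prefix_sum_total row_term_sum
    by (simp add: value_cells_def p row_cells_def)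
  show "achieves \<phi> (good cells (S(''v'' := q * Suc d + k)) ((=) r))
       (Cond (Less (Reg ''k'') (Num d))
         (Add (Cell ''v'' (Reg ''p''))
           (Cell ''sV'' (IAdd (IMul (IAdd (IMul (Reg ''q'') (Num d)) (Reg ''k'')) (Num (Suc d)))
             (Num d))) zero_cell)
         (Exp (Cell ''v'' (Reg ''p'')) zero_cell)) 1
       (good cells (S(''v'' := Suc (q * Suc d + k))) ((=) r))"
    using reg assms val less unfolding zero_cell_def p_def[symmetric]
    by (intro achieves_Cond achieves_Add achieves_Exp) (simp_all del: mult_Suc_right)
qed (use assms in \<open>auto simp: regs_def\<close>)

lemma achieves_interleave:
  assumes "S ''u'' = 0" "0 < S ''0''" "S ''fK'' = n * m" "S ''v'' = n * Suc d"
    and "S ''b'' = 2 * n - 1"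
  shows "achieves \<phi> (good cells S (regs n L)) (interleave d m) (2 ^ L * Q * 1)
    (good cells (S(''u'' := 2 ^ L * Q)) (regs n L))"
  unfolding interleave_def
proof (rule achieves_fill_array)
  fix q k r
  assume q: "q < 2 ^ L" and k: "k < Q" and r: "regs n L r"
    and reg: "r ''p'' = q * Q + k" "r ''q'' = q" "r ''k'' = k"
  define p where "p = q * Q + k"
  have batch: "batch_cells p = sequence k q"
    using k by (simp add: batch_cells_def p_def)
  have n: "r ''n'' = n"
    using r by (simp add: regs_def)
  have v: "q * Suc d + k mod Suc d < n * Suc d" if "q < n"
    using that by (intro flat_less) simp_all
  have f: "q * m + k div Suc d < n * m" if "q < n" "k < m * Suc d"
    using that by (intro flat_less less_mult_imp_div_less)
  \<comment> \<open>For these \<open>q\<close> the truncated subtraction agrees with the one in the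
    integers.\<close>
  have b: "b_cells (2 * n - 2 - q) = complex_of_real (b (int n - 1 - int q))" if "q < 2 * n - 1"
  proof -
    have "int (2 * n - 2 - q) - (int n - 1) = int n - 1 - int q"
      using that by linarith
    moreover have "2 * n - 2 - q < 2 * n - 1"
      using that by linarith
    ultimately show ?thesis
      by (simp only: b_cells_def if_True)
  qed
  show "achieves \<phi> (good cells (S(''u'' := q * Q + k)) ((=) r))
       (Cond (Less (Reg ''k'') (Num (m * Suc d)))
         (Cond (Less (Reg ''q'') (Reg ''n''))
           (Mul (Cell ''u'' (Reg ''p''))
             (Cell ''fK'' (IAdd (IMul (Reg ''q'') (Num m)) (IDiv (Reg ''k'') (Num (Suc d)))))
             (Cell ''v'' (IAdd (IMul (Reg ''q'') (Num (Suc d)))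
               (IMod (Reg ''k'') (Num (Suc d))))))
           (Add (Cell ''u'' (Reg ''p'')) zero_cell zero_cell))
         (Cond (Less (Reg ''q'') (ISub (IMul (Num 2) (Reg ''n'')) (Num 1)))
           (Exp (Cell ''u'' (Reg ''p''))
             (Cell ''b'' (ISub (ISub (IMul (Num 2) (Reg ''n'')) (Num 2)) (Reg ''q''))))
           (Add (Cell ''u'' (Reg ''p'')) zero_cell zero_cell))) 1
       (good cells (S(''u'' := Suc (q * Q + k))) ((=) r))"
    using reg assms batch n v f b unfolding zero_cell_def p_def[symmetric]
    by (intro achieves_Cond achieves_Add achieves_Mul achieves_Exp)
      (simp_all add: sequence_def del: mult_Suc_right)
qed (use assms in \<open>auto simp: regs_def Q_def\<close>)

lemma ival_batch_size: "regs n L r \<Longrightarrow> ival (batch_size d m) r = T"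
  by (simp add: batch_size_def regs_def T_def Q_def)

lemma fft_index_less:
  assumes "c < Q" "k < 2 ^ L"
  shows "L * T + (c * 2 ^ L + k) < Suc L * T"
  using flat_less[OF lessI flat_less[OF assms]] by (simp only: T_def)

lemma achieves_multiply_spectra:
  assumes "S ''y'' = 0" "S ''A'' = Suc L * T"
  shows "achieves \<phi> (good cells S (regs n L)) (multiply_spectra d m) (2 ^ L * Q * 1)
    (good cells (S(''y'' := 2 ^ L * Q)) (regs n L))"
  unfolding multiply_spectra_def
proof (rule achieves_fill_array)
  fix q k r
  assume q: "q < 2 ^ L" and k: "k < Q" and r: "regs n L r"
    and reg: "r ''p'' = q * Q + k" "r ''q'' = q" "r ''k'' = k"
  define p where "p = q * Q + k"
  have p: "p div Q = q" "p mod Q = k"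
    using k unfolding p_def by (rule flat_div, rule flat_mod)
  have "L * T + (k * 2 ^ L + q) < Suc L * T"
    using k q by (rule fft_index_less)
  moreover have "L * T + ((m * Suc d) * 2 ^ L + q) < Suc L * T"
    using q by (intro fft_index_less) (simp_all add: Q_def)
  ultimately show "achieves \<phi> (good cells (S(''y'' := q * Q + k)) ((=) r))
       (Mul (Cell ''y'' (Reg ''p''))
         (Cell ''A'' (IAdd (IMul (Reg ''E'') (batch_size d m))
           (IAdd (IMul (Reg ''k'') (Reg ''P'')) (Reg ''q''))))
         (Cell ''A'' (IAdd (IMul (Reg ''E'') (batch_size d m))
           (IAdd (IMul (Num (m * Suc d)) (Reg ''P'')) (Reg ''q''))))) 1
       (good cells (S(''y'' := Suc (q * Q + k))) ((=) r))"
    using reg r assms ival_batch_size[OF r] unfolding p_def[symmetric] regs_def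
    by - (rule achieves_Mul, simp_all add: product_cells_def p del: mult_Suc_right)
qed (use assms in \<open>auto simp: regs_def Q_def\<close>)

lemma achieves_mix_features:
  assumes n: "n \<ge> 2"
    and "S ''sZ'' = 0" "S ''tZ'' = 0" "0 < S ''0''" "S ''fQ'' = n * m" "S ''B'' = Suc L * T"
  shows "achieves \<phi> (good cells S (regs n L)) (mix_features d m) (n * Suc d * Suc m * 2)
    (good cells (S(''sZ'' := n * Suc d * Suc m, ''tZ'' := n * Suc d * Suc m)) (regs n L))"
  unfolding mix_features_def
proof (rule achieves_sum_products[where g = mix_term], goal_cases)
  \<comment> \<open>Case 14 is the premise about the two factors of each product; the other cases
    are side conditions on names, lengths and sizes.\<close>
  case (14 q k r)
  note q = 14(1) and k = 14(2) and r = 14(3) and reg = 14(4,5)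
  have i: "q div Suc d < n"
    using q by (rule less_mult_imp_div_less)
  then have f: "(q div Suc d) * m + k < n * m"
    using k by (rule flat_less)
  have "k * Suc d + q mod Suc d < m * Suc d"
    using k by (intro flat_less) simp_all
  then have "k * Suc d + q mod Suc d < Q"
    by (simp add: Q_def)
  \<comment> \<open>The subtrahend is positive because \<open>n \<ge> 2\<close>, so the frequency
    stays inside its block.\<close>
  moreover have "2 ^ L - (q div Suc d + n - 1) < (2 ^ L :: nat)"
    using n by (intro diff_less) auto
  ultimately have
    "L * T + ((k * Suc d + q mod Suc d) * 2 ^ L + (2 ^ L - (q div Suc d + n - 1))) < Suc L * T"
    by (rule fft_index_less)
  then show ?case
    using f reg r assms ival_batch_size[OF r] unfolding regs_def
    by (simp add: mix_term_def del: mult_Suc_right)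
qed (use assms in \<open>auto simp: regs_def\<close>)

lemma achieves_normalize_outputs:
  assumes "S ''z'' = 0" "S ''sZ'' = n * Suc d * Suc m"
    and den: "\<And>i. i < n \<Longrightarrow> (\<Sum>a<m. mix_term (i * Suc d + d) a) \<noteq> 0"
  shows "achieves \<phi> (good cells S (regs n L)) (normalize_outputs d m) (n * d * 1)
    (good cells (S(''z'' := n * d)) (regs n L))"
  unfolding normalize_outputs_def
proof (rule achieves_fill_array)
  fix q k r
  assume q: "q < n" and k: "k < d" and r: "regs n L r"
    and reg: "r ''p'' = q * d + k" "r ''q'' = q" "r ''k'' = k"
  define p where "p = q * d + k"
  have p: "p div d = q" "p mod d = k"
    using k unfolding p_def by (rule flat_div, rule flat_mod)
  have less: "(q * Suc d + l) * Suc m + m < n * Suc d * Suc m" if "l \<le> d" for l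
    using flat_less[OF flat_less[OF q], of l "Suc d" m "Suc m"] that by simp
  show "achieves \<phi> (good cells (S(''z'' := q * d + k)) ((=) r))
       (Div (Cell ''z'' (Reg ''p''))
         (Cell ''sZ'' (IAdd (IMul (IAdd (IMul (Reg ''q'') (Num (Suc d))) (Reg ''k''))
           (Num (Suc m))) (Num m)))
         (Cell ''sZ'' (IAdd (IMul (IAdd (IMul (Reg ''q'') (Num (Suc d))) (Num d))
           (Num (Suc m))) (Num m)))) 1
       (good cells (S(''z'' := Suc (q * d + k))) ((=) r))"
    using reg assms(1,2) less[of k] less[of d] k den[OF q] unfolding p_def[symmetric]
    by - (rule achieves_Div,
      simp_all add: output_cells_def p prefix_sum_total del: mult_Suc_right)
qed (use assms in \<open>auto simp: regs_def\<close>)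

section \<open>Correctness of the outputs\<close>

lemma fft_array_last:
  assumes "c < Q" "k < 2 ^ L"
  shows "fft_array T u (L * T + (c * 2 ^ L + k)) =
    (\<Sum>j<2 ^ L. u (j * Q + c) * unity_root (2 ^ L) (j * k))"
proof -
  have "c * 2 ^ L + k < T"
    unfolding T_def using assms by (rule flat_less)
  then have "(L * T + (c * 2 ^ L + k)) div T = L" "(L * T + (c * 2 ^ L + k)) mod T = c * 2 ^ L + k"
    by (rule flat_div, rule flat_mod)
  then show ?thesis
    unfolding fft_array_def T_def using fft_round_last[OF assms(2)] by simp
qed

lemma spectrum:
  assumes "c < Q" "k < 2 ^ L"
  shows "fft_array T batch_cells (L * T + (c * 2 ^ L + k)) =
    (\<Sum>j<2 ^ L. sequence c j * unity_root (2 ^ L) (j * k))"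
  using assms by (simp add: fft_array_last batch_cells_def)

text \<open>An instance of \<open>toeplitz_via_fourier\<close> with \<open>N = 2 ^ L\<close>: the
  layout of \<open>product_cells\<close> makes the product of spectrum \<open>c\<close> with the
  kernel spectrum appear as sequence \<open>c\<close> of the second batch.\<close>

lemma convolution:
  assumes n: "n \<ge> 2" and c: "c < m * Suc d" and i: "i < n"
  shows "fft_array T product_cells (L * T + (c * 2 ^ L + (2 ^ L - (i + n - 1)))) =
    2 ^ L * (\<Sum>j<n. sequence c j * complex_of_real (exp (b (int j - int i))))"
proof -
  let ?h = "sequence (m * Suc d)"
  have cQ: "c < Q" "m * Suc d < Q"
    using c by (simp_all add: Q_def)
  have N: "2 * n - 1 \<le> 2 ^ L"
    using two_le_power_log_size[of n] by (simp add: L_def)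
  have pos: "2 ^ L - (i + n - 1) < (2 ^ L :: nat)"
    using n by (intro diff_less) auto
  have "fft_array T product_cells (L * T + (c * 2 ^ L + (2 ^ L - (i + n - 1)))) =
      (\<Sum>k<2 ^ L. product_cells (k * Q + c) * unity_root (2 ^ L) (k * (2 ^ L - (i + n - 1))))"
    using cQ(1) pos by (rule fft_array_last)
  also have "\<dots> = (\<Sum>k<2 ^ L. (\<Sum>j<2 ^ L. sequence c j * unity_root (2 ^ L) (j * k)) *
      (\<Sum>l<2 ^ L. ?h l * unity_root (2 ^ L) (l * k)) * unity_root (2 ^ L) (k * (2 ^ L - (i + n - 1))))"
    using cQ by (intro sum.cong refl) (simp add: product_cells_def spectrum flat_div flat_mod)
  also have "\<dots> = of_nat (2 ^ L) * (\<Sum>j<n. sequence c j * ?h (i + n - 1 - j))"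
    using N i n by (rule toeplitz_via_fourier) (use c in \<open>simp add: sequence_def\<close>)
  also have "(\<Sum>j<n. sequence c j * ?h (i + n - 1 - j)) =
      (\<Sum>j<n. sequence c j * complex_of_real (exp (b (int j - int i))))"
  proof (intro sum.cong refl)
    fix j assume "j \<in> {..<n}"
    \<comment> \<open>Position \<open>i + n - 1 - j\<close> of the reversed kernel carries the
      offset \<open>j - i\<close>.\<close>
    then have "i + n - 1 - j < 2 * n - 1" "int n - 1 - int (i + n - 1 - j) = int j - int i"
      using i by auto
    then show "sequence c j * ?h (i + n - 1 - j) =
        sequence c j * complex_of_real (exp (b (int j - int i)))"
      by (simp add: sequence_def exp_of_real)
  qed
  finally show ?thesis by simp
qed

text \<open>The common form of numerators and denominators: \<open>w\<close> is a coordinate of the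
  values for the former and constantly 1 for the latter.\<close>

definition weighted_sum :: "(nat \<Rightarrow> real) \<Rightarrow> nat \<Rightarrow> real" where
  "weighted_sum w i =
     (\<Sum>a<m. (\<phi> (x (Suc i) v* WQ) $ coord a) *
        (\<Sum>j<n. exp (b (int j - int i)) * (\<phi> (x (Suc j) v* WK) $ coord a) * w j))"

text \<open>The column \<open>l = d\<close> is the appended coordinate, so a single computation
  covers numerators and denominators, with the same factor \<open>2 ^ L\<close>.\<close>

lemma mix_term_sum:
  assumes n: "n \<ge> 2" and i: "i < n" and l: "l \<le> d"
  shows "(\<Sum>a<m. mix_term (i * Suc d + l) a) =
    2 ^ L * complex_of_real
      (weighted_sum (\<lambda>j. if l < d then (x (Suc j) v* WV) $ coord l else 1) i)"
proof -
  have il: "(i * Suc d + l) div Suc d = i" "(i * Suc d + l) mod Suc d = l"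
    using l by (rule_tac flat_div, simp) (use l in \<open>rule_tac flat_mod, simp\<close>)
  have "mix_term (i * Suc d + l) a = 2 ^ L * complex_of_real
      ((\<phi> (x (Suc i) v* WQ) $ coord a) *
        (\<Sum>j<n. exp (b (int j - int i)) * (\<phi> (x (Suc j) v* WK) $ coord a) *
          (if l < d then (x (Suc j) v* WV) $ coord l else 1)))" if a: "a < m" for a
  proof -
    have c: "a * Suc d + l < m * Suc d"
      using a l by (intro flat_less) simp_all
    have "sequence (a * Suc d + l) j = complex_of_real ((\<phi> (x (Suc j) v* WK) $ coord a) *
        (if l < d then (x (Suc j) v* WV) $ coord l else 1))" if "j < n" for j
    proof -
      have "(a * Suc d + l) div Suc d = a" "(a * Suc d + l) mod Suc d = l"
          "(j * Suc d + l) div Suc d = j" "(j * Suc d + l) mod Suc d = l"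
        using l by (simp_all only: flat_div flat_mod less_Suc_eq_le)
      then show ?thesis
        using c that a unfolding sequence_def feature_cells_def value_cells_def
        by (simp del: mult_Suc_right)
    qed
    then show ?thesis
      unfolding mix_term_def il convolution[OF n c i] feature_cells_def
      using a by (simp add: sum_distrib_left mult_ac)
  qed
  then show ?thesis
    by (simp add: weighted_sum_def sum_distrib_left)
qed

lemma attention_num_eq:
  "attention_num \<phi> n x WQ WK WV b (Suc i) $ coord l =
    weighted_sum (\<lambda>j. (x (Suc j) v* WV) $ coord l) i"
proof -
  have "attention_num \<phi> n x WQ WK WV b (Suc i) $ coord l =
    (\<Sum>a\<in>UNIV. (\<phi> (x (Suc i) v* WQ) $ a) * (\<Sum>j<n. exp (b (int j - int i)) *
      (\<phi> (x (Suc j) v* WK) $ a) * (x (Suc j) v* WV) $ coord l))"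
    unfolding attention_num_def sum_atLeast1_atMost
    by (simp add: vector_matrix_mult_def[of "\<phi> _"] matrix_matrix_mult_def columnvector_def
        rowvector_def mult_ac)
  then show ?thesis
    unfolding weighted_sum_def by (simp only: sum_coord_m[symmetric])
qed

lemma attention_den_eq:
  "attention_den \<phi> n x WQ WK b (Suc i) = weighted_sum (\<lambda>j. 1) i"
proof -
  have "attention_den \<phi> n x WQ WK b (Suc i) =
    (\<Sum>a\<in>UNIV. (\<phi> (x (Suc i) v* WQ) $ a) * (\<Sum>j<n. exp (b (int j - int i)) *
      (\<phi> (x (Suc j) v* WK) $ a) * 1))"
    unfolding attention_den_def sum_atLeast1_atMost by (simp add: inner_vec_def)
  then show ?thesis
    unfolding weighted_sum_def by (simp only: sum_coord_m[symmetric])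
qed

lemma mix_term_sum_num:
  assumes "n \<ge> 2" "i < n" "l < d"
  shows "(\<Sum>a<m. mix_term (i * Suc d + l) a) =
    2 ^ L * complex_of_real (attention_num \<phi> n x WQ WK WV b (Suc i) $ coord l)"
  using assms mix_term_sum[of i l] by (simp add: attention_num_eq)

lemma mix_term_sum_den:
  assumes "n \<ge> 2" "i < n"
  shows "(\<Sum>a<m. mix_term (i * Suc d + d) a) =
    2 ^ L * complex_of_real (attention_den \<phi> n x WQ WK b (Suc i))"
  using assms mix_term_sum[of i d] by (simp add: attention_den_eq)

lemma output_cells_eq:
  assumes "n \<ge> 2" "i < n" "l < d"
  shows "output_cells (i * d + l) =
    complex_of_real (attention \<phi> n x WQ WK WV b (Suc i) $ coord l)"
proof -
  have "(i * d + l) div d = i" "(i * d + l) mod d = l"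
    using assms(3) by (simp_all only: flat_div flat_mod)
  then show ?thesis
    unfolding output_cells_def using assms
    by (simp only: mix_term_sum_num mix_term_sum_den attention_def)
      (simp add: divide_inverse mult_ac)
qed

section \<open>The whole program and its cost\<close>

definition input_lengths :: "name \<Rightarrow> nat" where
  "input_lengths = (\<lambda>_. 0)
     (''0'' := 1, ''x'' := n * d, ''WQ'' := d * d, ''WK'' := d * d, ''WV'' := d * d,
      ''b'' := 2 * n - 1)"

lemma good_input_state:
  "good cells input_lengths (\<lambda>r. r ''n'' = n) (input_state n x WQ WK WV b)"
  unfolding good_def input_state_def d_eq[symmetric]
  by (simp add: input_lengths_def x_cells_def b_cells_def)

text \<open>Origin of the cost, term by term: three matrix products with two operations per cell;
  packing of queries and keys together with the final divisions; two rounds of feature maps; the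
  augmented values; interleaving and multiplication of spectra; two transforms with three operations
  per entry; the mixing with query features.\<close>

lemma achieves_attention_program:
  assumes n: "n \<ge> 2" and den: "\<And>i. i \<in> {1..n} \<Longrightarrow> attention_den \<phi> n x WQ WK b i \<noteq> 0"
  shows "achieves \<phi> (good cells input_lengths (\<lambda>r. r ''n'' = n)) (attention_program d m)
    (6 * (n * d * Suc d) + 3 * (n * d) + 2 * n + n * Suc d + 2 * T + 6 * (Suc L * T) +
       2 * (n * Suc d * Suc m))
    (\<lambda>s. outputs s n (attention \<phi> n x WQ WK WV b))"
proof -
  have T: "2 ^ L * Q = T" "2 ^ L dvd T"
    by (simp_all add: T_def)
  define S1 where "S1 = input_lengths
    (''sQ'' := n * d * Suc d, ''tQ'' := n * d * Suc d, ''xQ'' := n * d, ''fQ'' := n * m)"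
  define S2 where "S2 = S1
    (''sK'' := n * d * Suc d, ''tK'' := n * d * Suc d, ''xK'' := n * d, ''fK'' := n * m)"
  define S3 where "S3 = S2(''sV'' := n * d * Suc d, ''tV'' := n * d * Suc d)"
  define S4 where "S4 = S3(''v'' := n * Suc d)"
  define S5 where "S5 = S4(''u'' := 2 ^ L * Q)"
  define S6 where "S6 = S5(''A'' := Suc L * T, ''Aw'' := Suc L * T, ''Av'' := Suc L * T)"
  define S7 where "S7 = S6(''y'' := 2 ^ L * Q)"
  define S8 where "S8 = S7(''B'' := Suc L * T, ''Bw'' := Suc L * T, ''Bv'' := Suc L * T)"
  define S9 where "S9 = S8(''sZ'' := n * Suc d * Suc m, ''tZ'' := n * Suc d * Suc m)"
  note S = S1_def S2_def S3_def S4_def S5_def S6_def S7_def S8_def S9_def input_lengths_def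
  have 0: "achieves \<phi> (good cells input_lengths (\<lambda>r. r ''n'' = n)) set_sizes 0
      (good cells input_lengths (regs n L))"
    unfolding L_def by (rule achieves_set_sizes)
  have 1: "achieves \<phi> (good cells input_lengths (regs n L))
      (feature_rows d m ''WQ'' ''sQ'' ''tQ'' ''xQ'' ''fQ'')
      (n * d * Suc d * 2 + (n * d * 1 + n * 1 * 1)) (good cells S1 (regs n L))"
    unfolding S1_def by (rule achieves_feature_rows[where M = WQ]) (simp_all add: S)
  have 2: "achieves \<phi> (good cells S1 (regs n L))
      (feature_rows d m ''WK'' ''sK'' ''tK'' ''xK'' ''fK'')
      (n * d * Suc d * 2 + (n * d * 1 + n * 1 * 1)) (good cells S2 (regs n L))"
    unfolding S2_def by (rule achieves_feature_rows[where M = WK]) (simp_all add: S)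
  have 3: "achieves \<phi> (good cells S2 (regs n L)) (row_products d ''WV'' ''sV'' ''tV'')
      (n * d * Suc d * 2) (good cells S3 (regs n L))"
    unfolding S3_def by (rule achieves_row_products[where M = WV]) (simp_all add: S)
  have 4: "achieves \<phi> (good cells S3 (regs n L)) (augment_values d) (n * Suc d * 1)
      (good cells S4 (regs n L))"
    unfolding S4_def by (rule achieves_augment_values) (simp_all add: S)
  have 5: "achieves \<phi> (good cells S4 (regs n L)) (interleave d m) (2 ^ L * Q * 1)
      (good cells S5 (regs n L))"
    unfolding S5_def by (rule achieves_interleave) (simp_all add: S)
  have 6: "achieves \<phi> (good cells S5 (regs n L))
      (fft ''u'' ''A'' ''Aw'' ''Av'' (batch_size d m)) (Suc L * T * 3) (good cells S6 (regs n L))"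
    unfolding S6_def using T ival_batch_size by (intro achieves_fft) (simp_all add: S)
  have 7: "achieves \<phi> (good cells S6 (regs n L)) (multiply_spectra d m) (2 ^ L * Q * 1)
      (good cells S7 (regs n L))"
    unfolding S7_def by (rule achieves_multiply_spectra) (simp_all add: S)
  have 8: "achieves \<phi> (good cells S7 (regs n L))
      (fft ''y'' ''B'' ''Bw'' ''Bv'' (batch_size d m)) (Suc L * T * 3) (good cells S8 (regs n L))"
    unfolding S8_def using T ival_batch_size by (intro achieves_fft) (simp_all add: S)
  have 9: "achieves \<phi> (good cells S8 (regs n L)) (mix_features d m) (n * Suc d * Suc m * 2)
      (good cells S9 (regs n L))"
    unfolding S9_def using n by (rule achieves_mix_features) (simp_all add: S)
  have 10: "achieves \<phi> (good cells S9 (regs n L)) (normalize_outputs d m) (n * d * 1)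
      (good cells (S9(''z'' := n * d)) (regs n L))"
  proof (rule achieves_normalize_outputs)
    fix i assume "i < n"
    then show "(\<Sum>a<m. mix_term (i * Suc d + d) a) \<noteq> 0"
      using den[of "Suc i"] unfolding mix_term_sum_den[OF n \<open>i < n\<close>] by simp
  qed (simp_all add: S)
  have out: "outputs s n (attention \<phi> n x WQ WK WV b)"
    if "good cells (S9(''z'' := n * d)) (regs n L) s" for s
    unfolding outputs_def d_eq[symmetric]
  proof (intro ballI allI impI)
    fix i k assume "i \<in> {1..n}" and k: "k < d"
    then obtain i' where i': "i = Suc i'" "i' < n"
      by (cases i) auto
    have "i' * d + k < n * d"
      using i'(2) k by (rule flat_less)
    then have "snd s ''z'' (i' * d + k) = output_cells (i' * d + k)"
      using that by (simp add: good_def)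
    then show "snd s ''z'' ((i - 1) * d + k) =
        complex_of_real (attention \<phi> n x WQ WK WV b i $ coord k)"
      using output_cells_eq[OF n i'(2) k] i'(1) by simp
  qed
  show ?thesis
    unfolding attention_program_def
  proof (rule achieves_conseq[OF achieves_Seq[OF 0 achieves_Seq[OF 1 achieves_Seq[OF 2
          achieves_Seq[OF 3 achieves_Seq[OF 4 achieves_Seq[OF 5 achieves_Seq[OF 6
          achieves_Seq[OF 7 achieves_Seq[OF 8 achieves_Seq[OF 9 10]]]]]]]]]]], goal_cases)
    case 3
    show ?case
      unfolding T(1) mult_1_right by linarith
  qed (use out in simp_all)
qed

text \<open>Only the transforms contribute the factor \<open>Suc L\<close>. Together with the two
  passes of length \<open>T\<close> they cost at most \<open>8 * (Suc L * T)\<close>, and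
  \<open>T \<le> 4 * Q * n\<close> turns 8 into 32; everything else is linear in
  \<open>n\<close>.\<close>

lemma cost_bound:
  assumes n: "n \<ge> 2"
  shows "6 * (n * d * Suc d) + 3 * (n * d) + 2 * n + n * Suc d + 2 * T + 6 * (Suc L * T) +
      2 * (n * Suc d * Suc m) \<le>
    (6 * (d * Suc d) + 3 * d + 2 + Suc d + 32 * Suc (m * Suc d) + 2 * (Suc d * Suc m)) *
      (n * Suc L)"
proof -
  have "2 ^ L \<le> 4 * n"
    unfolding L_def using n by (intro power_log_size_le) simp
  then have T: "T \<le> 4 * Q * n"
    unfolding T_def by (metis mult.assoc mult.commute mult_le_mono2)
  have 1: "a * n \<le> a * (n * Suc L)" for a
    by simp
  have "2 * T + 6 * (Suc L * T) \<le> 8 * (Suc L * T)"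
    by simp
  also have "\<dots> \<le> 8 * (Suc L * (4 * Q * n))"
    using T by (intro mult_le_mono2)
  finally have "2 * T + 6 * (Suc L * T) \<le> 32 * Q * (n * Suc L)"
    by (simp add: algebra_simps)
  moreover have "6 * (n * d * Suc d) + 3 * (n * d) + 2 * n + n * Suc d + 2 * (n * Suc d * Suc m) =
      (6 * (d * Suc d) + 3 * d + 2 + Suc d + 2 * (Suc d * Suc m)) * n"
    by (simp add: algebra_simps)
  moreover note 1[of "6 * (d * Suc d) + 3 * d + 2 + Suc d + 2 * (Suc d * Suc m)"]
  ultimately show ?thesis
    unfolding Q_def[symmetric] by (simp only: add_mult_distrib)
qed

end

text \<open>From \<open>2 ^ L \<le> 4 * n \<le> n ^ 3\<close> the exponent is at most three times
  the binary logarithm of \<open>n\<close>, and the successor costs one more because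
  \<open>ln 2 \<le> ln n\<close>; hence the 4. Both steps rest on \<open>n \<ge> 2\<close>.\<close>

lemma log_size_le:
  assumes n: "n \<ge> 2"
  shows "real (Suc (log_size n)) \<le> 4 / ln 2 * ln (real n)"
proof -
  define L where "L = log_size n"
  have "2 ^ L \<le> 4 * n"
    unfolding L_def using n by (intro power_log_size_le) simp
  also have "4 * n \<le> n ^ 3"
    using mult_le_mono[OF n n] by (simp add: power3_eq_cube)
  finally have "real (2 ^ L) \<le> real (n ^ 3)"
    by (simp only: of_nat_le_iff)
  then have "ln (2 ^ L :: real) \<le> ln (real n ^ 3)"
    using n by (subst ln_le_cancel_iff) auto
  then have "real L * ln 2 \<le> 3 * ln (real n)"
    using n by (simp add: ln_realpow)
  moreover have "ln 2 \<le> ln (real n)"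
    using n by simp
  ultimately have "real (Suc L) * ln 2 \<le> 4 * ln (real n)"
    by (simp add: algebra_simps)
  then show ?thesis
    by (simp add: L_def field_simps)
qed

theorem mainTheorem3:
  fixes \<phi> :: "real ^ 'd \<Rightarrow> real ^ 'm"
  shows "\<exists>(alg :: com) (C :: real). \<forall>(n :: nat) (x :: nat \<Rightarrow> real ^ 'd)
           (WQ :: real ^ 'd ^ 'd) (WK :: real ^ 'd ^ 'd) (WV :: real ^ 'd ^ 'd) (b :: int \<Rightarrow> real).
         n \<ge> 2 \<longrightarrow> (\<forall>i \<in> {1..n}. attention_den \<phi> n x WQ WK b i \<noteq> 0) \<longrightarrow>
         (\<exists>t s. exec \<phi> alg (input_state n x WQ WK WV b) t s \<and>
                outputs s n (attention \<phi> n x WQ WK WV b) \<and>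
                real t \<le> C * (real n * ln (real n)))"
proof -
  define d m where "d = CARD('d)" and "m = CARD('m)"
  \<comment> \<open>Program and constant are built from \<open>d\<close> and \<open>m\<close> alone,
    before \<open>n\<close> and the input are introduced; the factor \<open>4 / ln 2\<close> comes
    from \<open>log_size_le\<close>.\<close>
  define K where
    "K = 6 * (d * Suc d) + 3 * d + 2 + Suc d + 32 * Suc (m * Suc d) + 2 * (Suc d * Suc m)"
  have "\<exists>t s. exec \<phi> (attention_program d m) (input_state n x WQ WK WV b) t s \<and>
      outputs s n (attention \<phi> n x WQ WK WV b) \<and>
      real t \<le> real K * (4 / ln 2) * (real n * ln (real n))"
    if n: "n \<ge> 2" and den: "\<forall>i \<in> {1..n}. attention_den \<phi> n x WQ WK b i \<noteq> 0"
    for n x WQ WK WV b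
  proof -
    obtain t s where ex: "exec \<phi> (attention_program d m) (input_state n x WQ WK WV b) t s"
      and out: "outputs s n (attention \<phi> n x WQ WK WV b)"
      and le: "t \<le> 6 * (n * d * Suc d) + 3 * (n * d) + 2 * n + n * Suc d + 2 * T n d m +
        6 * (Suc (L n) * T n d m) + 2 * (n * Suc d * Suc m)"
      using achieves_attention_program[OF d_def m_def n, of \<phi> x WQ WK b WV] den
        good_input_state[OF d_def m_def, of \<phi> n x WQ WK WV b]
      unfolding achieves_def by blast
    have "t \<le> K * (n * Suc (log_size n))"
      using order_trans[OF le cost_bound[OF d_def m_def n]]
      unfolding K_def L_def[OF d_def m_def] .
    then have "real t \<le> real K * (real n * real (Suc (log_size n)))"
      by (metis of_nat_le_iff of_nat_mult)
    also have "\<dots> \<le> real K * (real n * (4 / ln 2 * ln (real n)))"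
      using log_size_le[OF n] by (intro mult_left_mono) simp_all
    also have "\<dots> = real K * (4 / ln 2) * (real n * ln (real n))"
      by (simp add: mult_ac)
    finally show ?thesis
      using ex out by blast
  qed
  then show ?thesis
    by blast
qed

end
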